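(* Let $(X_t)_{t\in\Delta}$ be the Kuranishi family of the Iwasawa manifold $X=X_0$. Then, for every $t\in\Delta_{[\gamma]}$, the metric $\omega_t=i\alpha_t\wedge\bar\alpha_t+i\beta_t\wedge\bar\beta_t+i\gamma_t\wedge\bar\gamma_t$ is a Gauduchon metric on $X_t$; hence $[\omega_t^2]_A$ defines an element in the Gauduchon cone $\mathcal G_{X_t}$ of $X_t$.
   Context: Iwasawa manifold: $X=X_0=G/\Gamma$, $G$ the Heisenberg group of upper unitriangular complex $3\times3$ matrices $\begin{pmatrix}1&z_1&z_3\\0&1&z_2\\0&0&1\end{pmatrix}$, $\Gamma\subset G$ the subgroup with entries in $\mathbb Z[i]$. $\alpha,\beta,\gamma$ are the holomorphic $1$-forms on $X$ induced by $dz_1,dz_2,dz_3-z_1dz_2$; $d\alpha=d\beta=0$, $d\gamma=-\alpha\wedge\beta$. $\xi_\alpha,\xi_\beta,\xi_\gamma$ is the dual frame of holomorphic vector fields. Deformations: $H^{0,1}(X,T^{1,0}X)$ has basis $\bar\alpha_\lambda\otimes\xi_i$ ($\alpha_1=\alpha,\alpha_2=\beta$, $\xi_1=\xi_\alpha,\xi_2=\xi_\beta,\xi_3=\xi_\gamma$; $\lambda=1,2$, $i=1,2,3$), with coordinates $t_{i\lambda}$. The Kuranishi family $(X_t)_{t\in\Delta}$ of $X$ is unobstructed and $\Delta$ is a small open ball about $0$ in this space (which may be shrunk). All $X_t$ have the same underlying $C^\infty$ manifold $X$; with $D(t)=t_{11}t_{22}-t_{12}t_{21}$, the complex structure of $X_t$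 has the $(1,0)$-coframe $\alpha_t=\alpha+t_{11}\bar\alpha+t_{12}\bar\beta$, $\beta_t=\beta+t_{21}\bar\alpha+t_{22}\bar\beta$, $\gamma_t=\gamma+t_{31}\bar\alpha+t_{32}\bar\beta-D(t)\bar\gamma$. $\Delta_{[\gamma]}:=\{t\in\Delta: t_{31}=t_{32}=0\}$. A Hermitian metric $\omega$ (positive definite $C^\infty$ $(1,1)$-form) on an $n$-dimensional compact complex manifold $Y$ is Gauduchon if $\partial\bar\partial\omega^{n-1}=0$. Aeppli cohomology: $H^{p,q}_A=\ker\partial\bar\partial/(\operatorname{Im}\partial+\operatorname{Im}\bar\partial)$. The Gauduchon cone $\mathcal G_Y\subset H^{n-1,n-1}_A(Y,\mathbb R)$ is the set of classes $[\omega^{n-1}]_A$ with $\omega$ a Gauduchon metric on $Y$. *)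

theory Defs
  imports "HOL-Analysis.Analysis"
begin

section \<open>Differential forms on quotients of a Euclidean space\<close>

text \<open>
  A complex-valued form of degree \<open>k\<close> at a point is a function on lists of tangent vectors that is
  real multilinear and alternating on the lists of length \<open>k\<close> and vanishes on all other lists.
  A differential form on a quotient of \<open>V\<close> by a group of diffeomorphisms acting freely and properly
  discontinuously is a form on \<open>V\<close> that is invariant under the group.
\<close>

type_synonym 'a multicovector = "'a list \<Rightarrow> complex"
type_synonym 'a form = "'a \<Rightarrow> 'a multicovector"

definition alternating :: "nat \<Rightarrow> 'a::real_vector multicovector \<Rightarrow> bool" where
  "alternating k A \<longleftrightarrow>
     (\<forall>vs. length vs \<noteq> k \<longrightarrow> A vs = 0) \<and>
     (\<forall>vs i. length vs = k \<longrightarrow> i < k \<longrightarrow> linear (\<lambda>v. A (vs[i := v]))) \<and>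
     (\<forall>vs. length vs = k \<longrightarrow> \<not> distinct vs \<longrightarrow> A vs = 0)"

definition covector :: "('a \<Rightarrow> complex) \<Rightarrow> 'a multicovector" where
  "covector f vs = (case vs of [v] \<Rightarrow> f v | _ \<Rightarrow> 0)"

definition conj_cov :: "'a multicovector \<Rightarrow> 'a multicovector" where
  "conj_cov A vs = cnj (A vs)"

definition one_cov :: "'a multicovector" where
  "one_cov vs = (if vs = [] then 1 else 0)"

text \<open>
  The wedge product as a sum over shuffles: \<open>S\<close> is the set of positions of the arguments that go
  to \<open>A\<close>, and the sign is that of the corresponding shuffle. Since multicovectors of degree \<open>k\<close>
  vanish on lists of length other than \<open>k\<close>, only sets \<open>S\<close> of the right cardinality contribute.
  Normalization: \<open>(\<phi> \<and> \<psi>)(v, w) = \<phi>(v) \<psi>(w) - \<phi>(w) \<psi>(v)\<close> for covectors \<open>\<phi>\<close> and \<open>\<psi>\<close>.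
\<close>

definition wedge :: "'a multicovector \<Rightarrow> 'a multicovector \<Rightarrow> 'a multicovector"  (infixr "\<and>\<^sub>w" 70) where
  "(A \<and>\<^sub>w B) vs =
     (\<Sum>S\<in>Pow {..<length vs}.
        (- 1) ^ card {(i, j). i \<in> S \<and> j \<in> {..<length vs} - S \<and> j < i} *
        A (nths vs S) * B (nths vs (- S)))"

definition wedge_list :: "'a multicovector list \<Rightarrow> 'a multicovector" where
  "wedge_list As = foldr (\<and>\<^sub>w) As one_cov"

definition form_power :: "'a form \<Rightarrow> nat \<Rightarrow> 'a form" where
  "form_power \<omega> k z = wedge_list (replicate k (\<omega> z))"

primrec times_cont_differentiable ::
  "nat \<Rightarrow> ('a::real_normed_vector \<Rightarrow> 'b::real_normed_vector) \<Rightarrow> bool" where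
  "times_cont_differentiable 0 f \<longleftrightarrow> continuous_on UNIV f"
| "times_cont_differentiable (Suc k) f \<longleftrightarrow>
     f differentiable_on UNIV \<and>
     (\<forall>v. times_cont_differentiable k (\<lambda>x. frechet_derivative f (at x) v))"

definition smooth :: "('a::real_normed_vector \<Rightarrow> 'b::real_normed_vector) \<Rightarrow> bool" where
  "smooth f \<longleftrightarrow> (\<forall>k. times_cont_differentiable k f)"

definition pullback :: "('a \<Rightarrow> 'a) \<Rightarrow> 'a form \<Rightarrow> 'a::real_normed_vector form" where
  "pullback g \<omega> z vs = \<omega> (g z) (map (frechet_derivative g (at z)) vs)"

definition ext_deriv :: "'a::real_normed_vector form \<Rightarrow> 'a form" where
  "ext_deriv \<omega> z vs =
     (\<Sum>i<length vs.
        (- 1) ^ i * frechet_derivative (\<lambda>x. \<omega> x (take i vs @ drop (Suc i) vs)) (at z) (vs ! i))"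

section \<open>Complex structures given by a global coframe\<close>

text \<open>
  The group \<open>deck\<close> acts on the universal cover \<open>'a\<close>, and \<open>coframe\<close> consists of invariant
  complex-valued 1-forms spanning the forms of type (1,0).
  The complex dimension is the length of the coframe.
\<close>

record 'a framed_quotient =
  deck :: "('a \<Rightarrow> 'a) set"
  coframe :: "'a form list"

definition cdim :: "'a framed_quotient \<Rightarrow> nat" where
  "cdim Y = length (coframe Y)"

definition smooth_forms :: "'a::euclidean_space framed_quotient \<Rightarrow> nat \<Rightarrow> 'a form set" where
  "smooth_forms Y k =
     {\<omega>. (\<forall>z. alternating k (\<omega> z)) \<and> (\<forall>vs. smooth (\<lambda>z. \<omega> z vs)) \<and> (\<forall>g\<in>deck Y. pullback g \<omega> = \<omega>)}"

definition coframe_at :: "'a framed_quotient \<Rightarrow> 'a \<Rightarrow> 'a multicovector list" where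
  "coframe_at Y z = map (\<lambda>\<theta>. \<theta> z) (coframe Y)"

definition pq_covectors :: "'a multicovector list \<Rightarrow> nat \<Rightarrow> nat \<Rightarrow> 'a multicovector set" where
  "pq_covectors \<Phi> p q =
     {\<lambda>vs. \<Sum>\<phi>s\<in>{\<phi>s. set \<phi>s \<subseteq> set \<Phi> \<and> length \<phi>s = p}. \<Sum>\<psi>s\<in>{\<psi>s. set \<psi>s \<subseteq> set \<Phi> \<and> length \<psi>s = q}.
        c \<phi>s \<psi>s * wedge_list (\<phi>s @ map conj_cov \<psi>s) vs | c. True}"

definition pq_forms :: "'a::euclidean_space framed_quotient \<Rightarrow> nat \<Rightarrow> nat \<Rightarrow> 'a form set" where
  "pq_forms Y p q = {\<omega> \<in> smooth_forms Y (p + q). \<forall>z. \<omega> z \<in> pq_covectors (coframe_at Y z) p q}"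

text \<open>
  The coframe and its conjugate form a basis of the complexified cotangent space if and only if the
  coframe maps the real tangent space bijectively onto \<open>\<complex>\<^sup>n\<close>. It then defines an almost complex
  structure, which is integrable if and only if the forms in the coframe have exterior derivatives
  without component of type (0,2) (Newlander--Nirenberg).
\<close>

definition complex_structure :: "'a::euclidean_space framed_quotient \<Rightarrow> bool" where
  "complex_structure Y \<longleftrightarrow>
     set (coframe Y) \<subseteq> smooth_forms Y 1 \<and>
     (\<forall>z. bij_betw (\<lambda>v. map (\<lambda>\<phi>. \<phi> [v]) (coframe_at Y z)) UNIV {ws. length ws = cdim Y}) \<and>
     (\<forall>\<theta>\<in>set (coframe Y). \<forall>z. \<exists>A\<in>pq_covectors (coframe_at Y z) 2 0.
        \<exists>B\<in>pq_covectors (coframe_at Y z) 1 1. ext_deriv \<theta> z = (\<lambda>vs. A vs + B vs))"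

definition cx_mult :: "'a framed_quotient \<Rightarrow> 'a \<Rightarrow> 'a \<Rightarrow> 'a" where
  "cx_mult Y z v = (THE w. \<forall>\<phi>\<in>set (coframe_at Y z). \<phi> [w] = \<i> * \<phi> [v])"

definition pq_part :: "'a framed_quotient \<Rightarrow> nat \<Rightarrow> nat \<Rightarrow> 'a form \<Rightarrow> 'a form" where
  "pq_part Y p q \<omega> z =
     (THE A. \<exists>C. (\<forall>r\<le>p + q. C r \<in> pq_covectors (coframe_at Y z) r (p + q - r)) \<and>
        \<omega> z = (\<lambda>vs. \<Sum>r\<le>p + q. C r vs) \<and> A = C p)"

text \<open>The Dolbeault operators on forms of type \<open>(p, q)\<close>.\<close>

definition del :: "'a::euclidean_space framed_quotient \<Rightarrow> nat \<Rightarrow> nat \<Rightarrow> 'a form \<Rightarrow> 'a form" where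
  "del Y p q \<omega> = pq_part Y (Suc p) q (ext_deriv \<omega>)"

definition delbar :: "'a::euclidean_space framed_quotient \<Rightarrow> nat \<Rightarrow> nat \<Rightarrow> 'a form \<Rightarrow> 'a form" where
  "delbar Y p q \<omega> = pq_part Y p (Suc q) (ext_deriv \<omega>)"

definition deldelbar :: "'a::euclidean_space framed_quotient \<Rightarrow> nat \<Rightarrow> nat \<Rightarrow> 'a form \<Rightarrow> 'a form" where
  "deldelbar Y p q \<omega> = del Y p (Suc q) (delbar Y p q \<omega>)"

definition real_form :: "'a form \<Rightarrow> bool" where
  "real_form \<omega> \<longleftrightarrow> (\<forall>z vs. \<omega> z vs \<in> \<real>)"

section \<open>Gauduchon metrics and Aeppli cohomology\<close>

text \<open>Positive definiteness: \<open>\<omega>(v, Jv) > 0\<close> for all \<open>v \<noteq> 0\<close>.\<close>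

definition hermitian_metric :: "'a::euclidean_space framed_quotient \<Rightarrow> 'a form \<Rightarrow> bool" where
  "hermitian_metric Y \<omega> \<longleftrightarrow>
     \<omega> \<in> pq_forms Y 1 1 \<and> real_form \<omega> \<and> (\<forall>z v. v \<noteq> 0 \<longrightarrow> 0 < Re (\<omega> z [v, cx_mult Y z v]))"

definition gauduchon_metric :: "'a::euclidean_space framed_quotient \<Rightarrow> 'a form \<Rightarrow> bool" where
  "gauduchon_metric Y \<omega> \<longleftrightarrow>
     hermitian_metric Y \<omega> \<and>
     deldelbar Y (cdim Y - 1) (cdim Y - 1) (form_power \<omega> (cdim Y - 1)) = (\<lambda>z vs. 0)"

definition im_del :: "'a::euclidean_space framed_quotient \<Rightarrow> nat \<Rightarrow> nat \<Rightarrow> 'a form set" where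
  "im_del Y p q = insert (\<lambda>z vs. 0) {del Y r q u | r u. Suc r = p \<and> u \<in> pq_forms Y r q}"

definition im_delbar :: "'a::euclidean_space framed_quotient \<Rightarrow> nat \<Rightarrow> nat \<Rightarrow> 'a form set" where
  "im_delbar Y p q = insert (\<lambda>z vs. 0) {delbar Y p s u | s u. Suc s = q \<and> u \<in> pq_forms Y p s}"

definition aeppli_closed :: "'a::euclidean_space framed_quotient \<Rightarrow> nat \<Rightarrow> nat \<Rightarrow> 'a form set" where
  "aeppli_closed Y p q = {\<omega> \<in> pq_forms Y p q. deldelbar Y p q \<omega> = (\<lambda>z vs. 0)}"

definition aeppli_class ::
  "'a::euclidean_space framed_quotient \<Rightarrow> nat \<Rightarrow> nat \<Rightarrow> 'a form \<Rightarrow> 'a form set" where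
  "aeppli_class Y p q \<omega> =
     {\<lambda>z vs. \<omega> z vs + \<eta> z vs + \<zeta> z vs | \<eta> \<zeta>. \<eta> \<in> im_del Y p q \<and> \<zeta> \<in> im_delbar Y p q}"

definition aeppli :: "'a::euclidean_space framed_quotient \<Rightarrow> nat \<Rightarrow> nat \<Rightarrow> 'a form set set" where
  "aeppli Y p q = aeppli_class Y p q ` aeppli_closed Y p q"

definition real_aeppli :: "'a::euclidean_space framed_quotient \<Rightarrow> nat \<Rightarrow> 'a form set set" where
  "real_aeppli Y p = {c \<in> aeppli Y p p. \<exists>\<omega>\<in>c. real_form \<omega>}"

definition gauduchon_cone :: "'a::euclidean_space framed_quotient \<Rightarrow> 'a form set set" where
  "gauduchon_cone Y =
     {c \<in> real_aeppli Y (cdim Y - 1).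
        \<exists>\<omega>. gauduchon_metric Y \<omega> \<and>
            c = aeppli_class Y (cdim Y - 1) (cdim Y - 1) (form_power \<omega> (cdim Y - 1))}"

section \<open>The Iwasawa manifold and its Kuranishi family\<close>

definition heis_matrix :: "complex^3 \<Rightarrow> complex^3^3" where
  "heis_matrix z = vector [vector [1, z$1, z$3], vector [0, 1, z$2], vector [0, 0, 1]]"

definition heis_mult :: "complex^3 \<Rightarrow> complex^3 \<Rightarrow> complex^3" where
  "heis_mult g z = vector [g$1 + z$1, g$2 + z$2, g$3 + z$3 + g$1 * z$2]"

lemma heis_matrix_mult: "heis_matrix (heis_mult g z) = heis_matrix g ** heis_matrix z"
  by (simp add: vec_eq_iff forall_3 heis_matrix_def heis_mult_def matrix_matrix_mult_def sum_3)

definition heis_lattice :: "(complex^3) set" where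
  "heis_lattice = {g. \<forall>i. Re (g$i) \<in> \<int> \<and> Im (g$i) \<in> \<int>}"

text \<open>
  The forms \<open>dz\<^sub>1\<close>, \<open>dz\<^sub>2\<close> and \<open>dz\<^sub>3 - z\<^sub>1 dz\<^sub>2\<close> are the entries of \<open>Z\<^sup>-\<^sup>1 dZ\<close>, so
  they are invariant under left translations, and the quotient is that by the left translations
  by elements of the lattice.
\<close>

definition iwasawa_deck :: "(complex^3 \<Rightarrow> complex^3) set" where
  "iwasawa_deck = heis_mult ` heis_lattice"

definition \<alpha> :: "(complex^3) form" where
  "\<alpha> z = covector (\<lambda>v. v$1)"

definition \<beta> :: "(complex^3) form" where
  "\<beta> z = covector (\<lambda>v. v$2)"

definition \<gamma> :: "(complex^3) form" where
  "\<gamma> z = covector (\<lambda>v. v$3 - z$1 * v$2)"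

text \<open>The coordinate \<open>t\<^sub>i\<^sub>\<lambda>\<close> of a deformation parameter is \<open>t $ i $ \<lambda>\<close>.\<close>

type_synonym kuranishi_param = "complex^2^3"

definition kuranishi_D :: "kuranishi_param \<Rightarrow> complex" where
  "kuranishi_D t = t$1$1 * t$2$2 - t$1$2 * t$2$1"

definition \<alpha>\<^sub>t :: "kuranishi_param \<Rightarrow> (complex^3) form" where
  "\<alpha>\<^sub>t t z vs = \<alpha> z vs + t$1$1 * conj_cov (\<alpha> z) vs + t$1$2 * conj_cov (\<beta> z) vs"

definition \<beta>\<^sub>t :: "kuranishi_param \<Rightarrow> (complex^3) form" where
  "\<beta>\<^sub>t t z vs = \<beta> z vs + t$2$1 * conj_cov (\<alpha> z) vs + t$2$2 * conj_cov (\<beta> z) vs"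

definition \<gamma>\<^sub>t :: "kuranishi_param \<Rightarrow> (complex^3) form" where
  "\<gamma>\<^sub>t t z vs = \<gamma> z vs + t$3$1 * conj_cov (\<alpha> z) vs + t$3$2 * conj_cov (\<beta> z) vs
     - kuranishi_D t * conj_cov (\<gamma> z) vs"

definition iwasawa_deform :: "kuranishi_param \<Rightarrow> (complex^3) framed_quotient" where
  "iwasawa_deform t = \<lparr>deck = iwasawa_deck, coframe = [\<alpha>\<^sub>t t, \<beta>\<^sub>t t, \<gamma>\<^sub>t t]\<rparr>"

definition \<omega>\<^sub>t :: "kuranishi_param \<Rightarrow> (complex^3) form" where
  "\<omega>\<^sub>t t z vs = \<i> * (\<alpha>\<^sub>t t z \<and>\<^sub>w conj_cov (\<alpha>\<^sub>t t z)) vs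
     + \<i> * (\<beta>\<^sub>t t z \<and>\<^sub>w conj_cov (\<beta>\<^sub>t t z)) vs
     + \<i> * (\<gamma>\<^sub>t t z \<and>\<^sub>w conj_cov (\<gamma>\<^sub>t t z)) vs"

text \<open>
  The base of the family may be any ball about the origin over which the given coframes define
  complex structures; such balls exist by \<open>exists_kuranishi_base\<close> below.
\<close>

definition kuranishi_base :: "kuranishi_param set \<Rightarrow> bool" where
  "kuranishi_base \<Delta> \<longleftrightarrow> (\<exists>r>0. \<Delta> = ball 0 r) \<and> (\<forall>t\<in>\<Delta>. complex_structure (iwasawa_deform t))"

definition base_\<gamma> :: "kuranishi_param set \<Rightarrow> kuranishi_param set" where
  "base_\<gamma> \<Delta> = {t \<in> \<Delta>. t$3$1 = 0 \<and> t$3$2 = 0}"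

section \<open>The deformed structures are complex near the origin\<close>

text \<open>
  With \<open>T\<close> the matrix of the \<open>t\<^sub>i\<^sub>\<lambda>\<close> for \<open>i \<le> 2\<close> and \<open>T'\<close> its complex conjugate, solving the coframe
  equations for \<open>\<alpha>\<close>, \<open>\<beta>\<close> and their conjugates divides by \<open>det (1 - T T')\<close>. In the resulting
  expression for \<open>d\<gamma>\<^sub>t\<close> the coefficient of type (0,2) is \<open>D(t) - D(t) = 0\<close>.
\<close>

lemma scaleR_complex_eq: "r *\<^sub>R (x::complex) = of_real r * x" by (rule scaleR_conv_of_real)

lemma length_nths_compl: "length (nths vs S) + length (nths vs (-S)) = length vs"
proof -
  have "length (nths vs S) = card {i. i < length vs \<and> i \<in> S}" by (rule length_nths)
  moreover have "length (nths vs (-S)) = card {i. i < length vs \<and> i \<in> -S}" by (rule length_nths)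
  moreover have "card {i. i < length vs \<and> i \<in> S} + card {i. i < length vs \<and> i \<in> -S} = card ({i. i < length vs \<and> i \<in> S} \<union> {i. i < length vs \<and> i \<in> -S})"
    by (rule card_Un_disjoint[symmetric]) auto
  moreover have "{i. i < length vs \<and> i \<in> S} \<union> {i. i < length vs \<and> i \<in> -S} = {..<length vs}" by auto
  ultimately show ?thesis by simp
qed

lemma wedge_degree:
  assumes "\<And>vs. length vs \<noteq> p \<Longrightarrow> A vs = 0" "\<And>vs. length vs \<noteq> q \<Longrightarrow> B vs = 0" "length vs \<noteq> p + q"
  shows "(A \<and>\<^sub>w B) vs = 0"
  unfolding wedge_def
proof (rule sum.neutral, rule ballI)
  fix S
  have "length (nths vs S) \<noteq> p \<or> length (nths vs (-S)) \<noteq> q"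
    using length_nths_compl[of vs S] assms(3) by auto
  then show "(- 1) ^ card {(i, j). i \<in> S \<and> j \<in> {..<length vs} - S \<and> j < i} * A (nths vs S) * B (nths vs (- S)) = 0"
    using assms(1,2) by auto
qed

lemma Pow_lessThan_1: "Pow {..<Suc 0} = {{}, {0}}" by (auto)
lemma Pow_lessThan_2: "Pow {..<2} = {{}, {0}, {1}, {0,1::nat}}"
  by (auto simp: less_2_cases_iff) 

lemma wedge_one_right_single: "f [] = 0 \<Longrightarrow> ([v]::'a list) = vs \<Longrightarrow> (f \<and>\<^sub>w one_cov) vs = f [v]"
proof -
  assume a: "f [] = 0" "[v] = vs"
  have e: "{(i, j). i = 0 \<and> j = 0 \<and> 0 < j \<and> j < (i::nat)} = {}" by auto
  show ?thesis using a by (auto simp: wedge_def Pow_lessThan_1 one_cov_def nths_Cons e)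
qed

lemma wedge_covectors:
  assumes "\<And>vs. length vs \<noteq> 1 \<Longrightarrow> f vs = 0" "\<And>vs. length vs \<noteq> 1 \<Longrightarrow> g vs = 0"
  shows "(f \<and>\<^sub>w g) [v,w] = f [v] * g [w] - f [w] * g [v]"
proof -
  have c: "card {(i, j). i \<in> {Suc 0} \<and> j \<in> {..<2} - {Suc 0} \<and> j < i} = 1"
  proof -
    have "{(i, j). i \<in> {Suc 0} \<and> j \<in> {..<2} - {Suc 0} \<and> j < i} = {(1,0)}" by (auto)
    then show ?thesis by simp
  qed
  have c0: "card {(i, j). i \<in> {0::nat} \<and> j \<in> {..<2} - {0} \<and> j < i} = 0"
    by (rule trans[OF arg_cong[of _ "{}" card] card.empty]) auto
  have l: "length [v,w] = 2" by simp
  show ?thesis unfolding wedge_def l Pow_lessThan_2 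
    using c c0 by (simp add: nths_Cons assms(1)[of "[]"] assms(2)[of "[]"])
qed

lemma wedge_one_right:
  assumes "\<And>vs. length vs \<noteq> 1 \<Longrightarrow> f vs = 0" 
  shows "(f \<and>\<^sub>w one_cov) = f"
proof
  fix vs show "(f \<and>\<^sub>w one_cov) vs = f vs"
  proof (cases "length vs = 1")
    case True then obtain v where v: "vs = [v]" by (auto simp: length_Suc_conv)
    then show ?thesis using wedge_one_right_single[of f v vs] assms[of "[]"] by simp
  next
    case False 
    have "(f \<and>\<^sub>w one_cov) vs = 0" 
      by (rule wedge_degree[of 1 _ 0]) (use assms False in \<open>auto simp: one_cov_def\<close>)
    with False assms show ?thesis by simp
  qed
qed

definition bicovector :: "('a \<Rightarrow> 'a \<Rightarrow> complex) \<Rightarrow> 'a list \<Rightarrow> complex" where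
 "bicovector F vs = (case vs of [v,w] \<Rightarrow> F v w | _ \<Rightarrow> 0)"

lemma wedge_list_covectors:
  assumes "\<And>vs. length vs \<noteq> 1 \<Longrightarrow> f vs = 0" "\<And>vs. length vs \<noteq> 1 \<Longrightarrow> g vs = 0"
  shows "wedge_list [f,g] = bicovector (\<lambda>v w. f [v] * g [w] - f [w] * g [v])"
proof
  fix vs
  have e: "wedge_list [f,g] = (f \<and>\<^sub>w g)" by (simp add: wedge_list_def wedge_one_right assms)
  show "wedge_list [f,g] vs = bicovector (\<lambda>v w. f [v] * g [w] - f [w] * g [v]) vs"
  proof (cases "length vs = 2")
    case True then obtain v w where v: "vs = [v,w]" by (auto simp: length_Suc_conv numeral_2_eq_2)
    then show ?thesis unfolding e using wedge_covectors[of f g v w] assms by (simp add: bicovector_def)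
  next
    case False 
    have "(f \<and>\<^sub>w g) vs = 0" 
      by (rule wedge_degree[of 1 _ 1]) (use assms False in \<open>auto simp: one_cov_def\<close>)
    with False  show ?thesis unfolding e by (auto simp: bicovector_def split: list.splits)
  qed
qed

lemma pq_covectors_single:
  assumes "set \<phi> \<subseteq> set P" "length \<phi> = p" "set \<psi> \<subseteq> set P" "length \<psi> = q"
  shows "(\<lambda>vs. k * wedge_list (\<phi> @ map conj_cov \<psi>) vs) \<in> pq_covectors P p q"
proof -
  have "(\<lambda>vs. k * wedge_list (\<phi> @ map conj_cov \<psi>) vs) =
   (\<lambda>vs. \<Sum>\<phi>s\<in>{\<phi>s. set \<phi>s \<subseteq> set P \<and> length \<phi>s = p}. \<Sum>\<psi>s\<in>{\<psi>s. set \<psi>s \<subseteq> set P \<and> length \<psi>s = q}.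
        (if \<phi>s = \<phi> \<and> \<psi>s = \<psi> then k else 0) * wedge_list (\<phi>s @ map conj_cov \<psi>s) vs)"
  proof
    fix vs
    have f: "finite {\<phi>s. set \<phi>s \<subseteq> set P \<and> length \<phi>s = n}" for n by (rule finite_lists_length_eq) simp
    have "(\<Sum>\<phi>s\<in>{\<phi>s. set \<phi>s \<subseteq> set P \<and> length \<phi>s = p}. \<Sum>\<psi>s\<in>{\<psi>s. set \<psi>s \<subseteq> set P \<and> length \<psi>s = q}.
        (if \<phi>s = \<phi> \<and> \<psi>s = \<psi> then k else 0) * wedge_list (\<phi>s @ map conj_cov \<psi>s) vs)
       = (\<Sum>\<phi>s\<in>{\<phi>s. set \<phi>s \<subseteq> set P \<and> length \<phi>s = p}. if \<phi>s = \<phi> then (\<Sum>\<psi>s\<in>{\<psi>s. set \<psi>s \<subseteq> set P \<and> length \<psi>s = q}.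
        (if \<psi>s = \<psi> then k * wedge_list (\<phi>s @ map conj_cov \<psi>s) vs else 0)) else 0)"
      by (intro sum.cong refl) (auto intro!: sum.cong sum.neutral)
    also have "\<dots> = k * wedge_list (\<phi> @ map conj_cov \<psi>) vs"
      using f assms by simp
    finally show "k * wedge_list (\<phi> @ map conj_cov \<psi>) vs = (\<Sum>\<phi>s\<in>{\<phi>s. set \<phi>s \<subseteq> set P \<and> length \<phi>s = p}. \<Sum>\<psi>s\<in>{\<psi>s. set \<psi>s \<subseteq> set P \<and> length \<psi>s = q}.
        (if \<phi>s = \<phi> \<and> \<psi>s = \<psi> then k else 0) * wedge_list (\<phi>s @ map conj_cov \<psi>s) vs)" by simp
  qed
  then show ?thesis unfolding pq_covectors_def mem_Collect_eq by (intro exI[of _ "\<lambda>\<phi>s \<psi>s. if \<phi>s = \<phi> \<and> \<psi>s = \<psi> then k else 0"] conjI TrueI)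
qed

lemma pq_covectors_add: 
  assumes "A \<in> pq_covectors P p q" "B \<in> pq_covectors P p q"
  shows "(\<lambda>vs. A vs + B vs) \<in> pq_covectors P p q"
proof -
  obtain c d where "A = (\<lambda>vs. \<Sum>\<phi>s\<in>{\<phi>s. set \<phi>s \<subseteq> set P \<and> length \<phi>s = p}. \<Sum>\<psi>s\<in>{\<psi>s. set \<psi>s \<subseteq> set P \<and> length \<psi>s = q}. c \<phi>s \<psi>s * wedge_list (\<phi>s @ map conj_cov \<psi>s) vs)"
   "B = (\<lambda>vs. \<Sum>\<phi>s\<in>{\<phi>s. set \<phi>s \<subseteq> set P \<and> length \<phi>s = p}. \<Sum>\<psi>s\<in>{\<psi>s. set \<psi>s \<subseteq> set P \<and> length \<psi>s = q}. d \<phi>s \<psi>s * wedge_list (\<phi>s @ map conj_cov \<psi>s) vs)"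
    using assms unfolding pq_covectors_def by blast
  then show ?thesis unfolding pq_covectors_def
    by (auto simp: sum.distrib[symmetric] algebra_simps intro!: exI[of _ "\<lambda>x y. c x y + d x y"])
qed

lemma frechet_derivative_affine: "bounded_linear L \<Longrightarrow> frechet_derivative (\<lambda>x. c + L x) (at x) = L"
  by (rule frechet_derivative_at[symmetric]) (auto intro!: derivative_eq_intros bounded_linear_imp_has_derivative)

lemma times_cont_differentiable_const: "times_cont_differentiable k (\<lambda>x. c)"
  by (induction k arbitrary: c) (auto simp: frechet_derivative_const[abs_def])

lemma smooth_affine: 
  assumes "bounded_linear L" shows "smooth (\<lambda>x. c + L x)"
  unfolding smooth_def
proof 
  fix k show "times_cont_differentiable k (\<lambda>x. c + L x)"
  proof (cases k)
    case 0
    then show ?thesis using assms by (simp add: continuous_on_add linear_continuous_on)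
  next
    case (Suc j)
    have "(\<lambda>x. c + L x) differentiable_on UNIV"
      by (intro differentiable_on_add differentiable_on_const bounded_linear_imp_differentiable_on assms)
    then show ?thesis using Suc by (simp add: frechet_derivative_affine[OF assms] times_cont_differentiable_const)
  qed
qed

definition gamma_fun :: "kuranishi_param \<Rightarrow> complex^3 \<Rightarrow> complex^3 \<Rightarrow> complex" where
 "gamma_fun t z v = v$3 - z$1 * v$2 + t$3$1 * cnj (v$1) + t$3$2 * cnj (v$2) - kuranishi_D t * cnj (v$3 - z$1 * v$2)"

lemma alpha_t_eq: "\<alpha>\<^sub>t t z = covector (\<lambda>v. v$1 + t$1$1 * cnj (v$1) + t$1$2 * cnj (v$2))"
  by (auto simp: \<alpha>\<^sub>t_def \<alpha>_def \<beta>_def covector_def conj_cov_def split: list.splits)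
lemma beta_t_eq: "\<beta>\<^sub>t t z = covector (\<lambda>v. v$2 + t$2$1 * cnj (v$1) + t$2$2 * cnj (v$2))"
  by (auto simp: \<beta>\<^sub>t_def \<alpha>_def \<beta>_def covector_def conj_cov_def split: list.splits)
lemma gamma_t_eq: "\<gamma>\<^sub>t t z = covector (gamma_fun t z)"
  by (auto simp: \<gamma>\<^sub>t_def \<alpha>_def \<beta>_def \<gamma>_def covector_def conj_cov_def gamma_fun_def split: list.splits)

lemma linear_coframe: "linear (gamma_fun t z)" "linear (\<lambda>v::complex^3. v$1 + t$1$1 * cnj (v$1) + t$1$2 * cnj (v$2))" "linear (\<lambda>v::complex^3. v$2 + t$2$1 * cnj (v$1) + t$2$2 * cnj (v$2))"
  by (auto intro!: linearI simp: gamma_fun_def algebra_simps scaleR_complex_eq)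

lemma alternating_covector: "linear f \<Longrightarrow> alternating 1 (covector f)"
  by (auto simp: alternating_def covector_def length_Suc_conv split: list.splits)

lemma frechet_derivative_heis_mult: "frechet_derivative (heis_mult g) (at z) = (\<lambda>v. vector [v$1, v$2, v$3 + g$1 * v$2])"
proof -
  let ?L = "\<lambda>v::complex^3. (vector [v$1, v$2, v$3 + g$1 * v$2]) :: complex^3"
  have "heis_mult g = (\<lambda>z. g + ?L z)"
    by (auto simp: heis_mult_def vec_eq_iff forall_3)
  moreover have "bounded_linear ?L"
    by (intro linear_conv_bounded_linear[THEN iffD1] linearI) (auto simp: vec_eq_iff forall_3 algebra_simps)
  ultimately show ?thesis using frechet_derivative_affine[of ?L g z] by simp
qed

lemma pullback_coframe: 
  "pullback (heis_mult g) (\<alpha>\<^sub>t t) = \<alpha>\<^sub>t t"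
  "pullback (heis_mult g) (\<beta>\<^sub>t t) = \<beta>\<^sub>t t"
  "pullback (heis_mult g) (\<gamma>\<^sub>t t) = \<gamma>\<^sub>t t"
  by (auto intro!: ext simp: pullback_def frechet_derivative_heis_mult alpha_t_eq beta_t_eq gamma_t_eq gamma_fun_def covector_def heis_mult_def algebra_simps split: list.splits)

lemma smooth_gamma_fun: "smooth (\<lambda>z. gamma_fun t z v)"
proof -
  let ?L = "\<lambda>z::complex^3. - z$1 * v$2 + kuranishi_D t * cnj (z$1 * v$2)"
  have e: "(\<lambda>z. gamma_fun t z v) = (\<lambda>z. (v$3 + t$3$1 * cnj (v$1) + t$3$2 * cnj (v$2) - kuranishi_D t * cnj (v$3)) + ?L z)"
    by (auto simp: gamma_fun_def algebra_simps)
  have "bounded_linear ?L"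
    by (intro linear_conv_bounded_linear[THEN iffD1] linearI) (auto simp: algebra_simps scaleR_complex_eq)
  then show ?thesis unfolding e by (rule smooth_affine)
qed

lemma smooth_coframe: "smooth (\<lambda>z. \<alpha>\<^sub>t t z vs)" "smooth (\<lambda>z. \<beta>\<^sub>t t z vs)" "smooth (\<lambda>z. \<gamma>\<^sub>t t z vs)"
  by (cases vs rule: remdups_adj.cases; auto simp: alpha_t_eq beta_t_eq gamma_t_eq covector_def smooth_def times_cont_differentiable_const smooth_gamma_fun[unfolded smooth_def])+

lemma coframe_smooth_forms: "{\<alpha>\<^sub>t t, \<beta>\<^sub>t t, \<gamma>\<^sub>t t} \<subseteq> smooth_forms (iwasawa_deform t) 1"
  using smooth_coframe by (auto simp: smooth_forms_def iwasawa_deform_def iwasawa_deck_def pullback_coframe) 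
   (auto simp: alpha_t_eq beta_t_eq gamma_t_eq intro!: alternating_covector[simplified] linear_coframe)

lemma param_bound: "t \<in> ball 0 (1/4) \<Longrightarrow> norm (t$i$j) < 1/4"
  for t::kuranishi_param
  using Finite_Cartesian_Product.norm_nth_le[of t i] Finite_Cartesian_Product.norm_nth_le[of "t$i" j] by (simp add: dist_norm)

lemma kuranishi_D_bound: assumes "t \<in> ball 0 (1/4)" shows "norm (kuranishi_D t) \<le> 1/8"
proof -
  have "norm (t$i$j * t$k$l) \<le> 1/4 * (1/4)" for i j k l
    unfolding norm_mult using param_bound[OF assms, of i j] param_bound[OF assms, of k l] by (intro mult_mono) auto
  from this[of 1 1 2 2] this[of 1 2 2 1] show ?thesis unfolding kuranishi_D_def
    using norm_triangle_ineq4[of "t$1$1 * t$2$2" "t$1$2 * t$2$1"] by linarith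
qed

lemma norm_le_of_sum_zero: "a + b + c = 0 \<Longrightarrow> cmod a \<le> cmod b + cmod c"
  by (metis add.assoc add_eq_0_iff norm_minus_cancel norm_triangle_ineq)

lemma coframe_bij:
  assumes t: "t \<in> ball 0 (1/4)"
  shows "bij_betw (\<lambda>v. map (\<lambda>\<phi>. \<phi> [v]) (coframe_at (iwasawa_deform t) z)) UNIV {ws. length ws = cdim (iwasawa_deform t)}"
proof -
  let ?F = "\<lambda>v::complex^3. (vector [v$1 + t$1$1 * cnj (v$1) + t$1$2 * cnj (v$2), v$2 + t$2$1 * cnj (v$1) + t$2$2 * cnj (v$2), gamma_fun t z v])::complex^3"
  have lin: "linear ?F"
    by (auto intro!: linearI simp: gamma_fun_def algebra_simps scaleR_complex_eq vec_eq_iff forall_3)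
  have "v = 0" if "?F v = 0" for v
  proof -
    have e: "v$1 + t$1$1 * cnj (v$1) + t$1$2 * cnj (v$2) = 0" "v$2 + t$2$1 * cnj (v$1) + t$2$2 * cnj (v$2) = 0" "gamma_fun t z v = 0"
      using that by (auto simp: vec_eq_iff forall_3)
    have b: "cmod (t$i$j * cnj x) \<le> cmod x / 4" for i j x
      unfolding norm_mult using param_bound[OF t, of i j] mult_right_mono[of "cmod (t$i$j)" "1/4" "cmod x"] by simp
    have "cmod (v$1) \<le> cmod (v$1)/4 + cmod (v$2)/4" "cmod (v$2) \<le> cmod (v$1)/4 + cmod (v$2)/4"
      using norm_le_of_sum_zero[OF e(1)] norm_le_of_sum_zero[OF e(2)] b[of 1 1 "v$1"] b[of 1 2 "v$2"] b[of 2 1 "v$1"] b[of 2 2 "v$2"] by linarith+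
    then have "cmod (v$1) + cmod (v$2) \<le> 0" by linarith
    then have v: "v$1 = 0" "v$2 = 0" 
      using norm_ge_zero[of "v$1"] norm_ge_zero[of "v$2"] by (simp_all add: add_nonneg_eq_0_iff le_less)
    then have "v$3 = kuranishi_D t * cnj (v$3)" using e(3) by (simp add: gamma_fun_def)
    then have "cmod (v$3) = cmod (kuranishi_D t) * cmod (v$3)" by (metis norm_mult complex_mod_cnj)
    also have "\<dots> \<le> 1/8 * cmod (v$3)" using kuranishi_D_bound[OF t] by (intro mult_right_mono) auto
    finally have "v$3 = 0" by simp
    with v show "v = 0" by (auto simp: vec_eq_iff forall_3)
  qed
  then have inj: "inj ?F" using linear_injective_0[OF lin] by blast
  then have sur: "surj ?F" using linear_injective_imp_surjective[OF lin] by blast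
  have e: "(\<lambda>v. map (\<lambda>\<phi>. \<phi> [v]) (coframe_at (iwasawa_deform t) z)) = (\<lambda>w. [w$1,w$2,w$3]) \<circ> ?F"
    by (auto simp: coframe_at_def iwasawa_deform_def alpha_t_eq beta_t_eq gamma_t_eq covector_def)
  have b1: "bij_betw (\<lambda>w::complex^3. [w$1,w$2,w$3]) UNIV {ws. length ws = 3}"
    unfolding bij_betw_def
  proof
    show "inj (\<lambda>w::complex^3. [w$1,w$2,w$3])" by (auto simp: inj_def vec_eq_iff forall_3)
    show "range (\<lambda>w::complex^3. [w$1,w$2,w$3]) = {ws. length ws = 3}"
    proof (intro equalityI subsetI)
      fix ws :: "complex list" assume "ws \<in> {ws. length ws = 3}"
      then obtain a b c where "ws = [a,b,c]" by (auto simp: length_Suc_conv numeral_3_eq_3)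
      then have "ws = (\<lambda>w::complex^3. [w$1,w$2,w$3]) (vector [a,b,c])" by simp
      then show "ws \<in> range (\<lambda>w::complex^3. [w$1,w$2,w$3])" by blast
    qed auto
  qed
  have b2: "bij_betw ?F UNIV UNIV" using inj sur by (auto simp: bij_betw_def)
  have c: "cdim (iwasawa_deform t) = 3" by (simp add: cdim_def iwasawa_deform_def)
  show ?thesis unfolding e c by (rule bij_betw_trans[OF b2 b1])
qed

lemma ext_deriv_const: "(\<And>z. \<theta> z = covector f) \<Longrightarrow> ext_deriv \<theta> z = (\<lambda>vs. 0)"
  by (auto simp: ext_deriv_def fun_eq_iff)

lemma frechet_derivative_gamma_fun: "frechet_derivative (\<lambda>z. gamma_fun t z v) (at z) w = - w$1 * v$2 + kuranishi_D t * cnj (w$1 * v$2)"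
proof -
  let ?L = "\<lambda>z::complex^3. - z$1 * v$2 + kuranishi_D t * cnj (z$1 * v$2)"
  have e: "(\<lambda>z. gamma_fun t z v) = (\<lambda>z. (v$3 + t$3$1 * cnj (v$1) + t$3$2 * cnj (v$2) - kuranishi_D t * cnj (v$3)) + ?L z)"
    by (auto simp: gamma_fun_def algebra_simps)
  have "bounded_linear ?L"
    by (intro linear_conv_bounded_linear[THEN iffD1] linearI) (auto simp: algebra_simps scaleR_complex_eq)
  then show ?thesis unfolding e by (simp only: frechet_derivative_affine)
qed

lemma covector_eq_0: "length vs \<noteq> 1 \<Longrightarrow> covector f vs = 0"
  by (auto simp: covector_def split: list.splits)

lemma ext_deriv_gamma_t: "ext_deriv (\<gamma>\<^sub>t t) z = bicovector (\<lambda>v w. - (v$1 * w$2 - w$1 * v$2) + kuranishi_D t * cnj (v$1 * w$2 - w$1 * v$2))"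
proof 
  fix vs :: "(complex^3) list"
  consider "length vs \<noteq> 2" | v w where "vs = [v,w]" 
    by (auto simp: length_Suc_conv numeral_2_eq_2)
  then show "ext_deriv (\<gamma>\<^sub>t t) z vs = bicovector (\<lambda>v w. - (v$1 * w$2 - w$1 * v$2) + kuranishi_D t * cnj (v$1 * w$2 - w$1 * v$2)) vs"
  proof cases
    case 1
    have "\<gamma>\<^sub>t t x (take i vs @ drop (Suc i) vs) = 0" if "i < length vs" for i x
    proof -
      have "length (take i vs @ drop (Suc i) vs) \<noteq> 1" using that 1 by auto
      then show ?thesis unfolding gamma_t_eq by (rule covector_eq_0)
    qed
    then have "ext_deriv (\<gamma>\<^sub>t t) z vs = 0" by (auto simp: ext_deriv_def)
    then show ?thesis using 1 by (auto simp: bicovector_def split: list.splits)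
  next
    case 2
    have "ext_deriv (\<gamma>\<^sub>t t) z vs = frechet_derivative (\<lambda>x. \<gamma>\<^sub>t t x [w]) (at z) v - frechet_derivative (\<lambda>x. \<gamma>\<^sub>t t x [v]) (at z) w"
      by (simp add: ext_deriv_def 2 numeral_2_eq_2 lessThan_Suc)
    also have "\<dots> = bicovector (\<lambda>v w. - (v$1 * w$2 - w$1 * v$2) + kuranishi_D t * cnj (v$1 * w$2 - w$1 * v$2)) vs"
      by (simp add: gamma_t_eq covector_def frechet_derivative_gamma_fun 2 bicovector_def algebra_simps)
    finally show ?thesis .
  qed
qed

lemma torsion_identity:
  fixes p q r s P Q R S :: complex
  assumes a: "a1 = x1 + p * X1 + q * Y1" "b1 = y1 + r * X1 + s * Y1" "A1 = X1 + P * x1 + Q * y1" "B1 = Y1 + R * x1 + S * y1"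
    "a2 = x2 + p * X2 + q * Y2" "b2 = y2 + r * X2 + s * Y2" "A2 = X2 + P * x2 + Q * y2" "B2 = Y2 + R * x2 + S * y2"
  shows "((1 - p * P - q * R) * (1 - r * Q - s * S) - (p * Q + q * S) * (r * P + s * R)) * (- (x1 * y2 - x2 * y1) + (p * s - q * r) * (X1 * Y2 - X2 * Y1)) =
      ((p * s - q * r) * (P * S - Q * R) - 1) * (a1 * b2 - a2 * b1) + (r + (p * s - q * r) * R) * (a1 * A2 - a2 * A1)
       + (s - (p * s - q * r) * P) * (a1 * B2 - a2 * B1)
       + ((p * s - q * r) * S - p) * (b1 * A2 - b2 * A1) - (q + (p * s - q * r) * Q) * (b1 * B2 - b2 * B1)"
  unfolding a by algebra

lemma param_det_nonzero:
  fixes t :: kuranishi_param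
  assumes t: "t \<in> ball 0 (1/4)"
  shows "(1 - t$1$1 * cnj (t$1$1) - t$1$2 * cnj (t$2$1)) * (1 - t$2$1 * cnj (t$1$2) - t$2$2 * cnj (t$2$2)) 
    - (t$1$1 * cnj (t$1$2) + t$1$2 * cnj (t$2$2)) * (t$2$1 * cnj (t$1$1) + t$2$2 * cnj (t$2$1)) \<noteq> 0"
proof
  have m: "norm (t$i$j * cnj (t$k$l)) \<le> 1/16" for i j k l
    unfolding norm_mult complex_mod_cnj using mult_mono[of "cmod (t$i$j)" "1/4" "cmod (t$k$l)" "1/4"] param_bound[OF t, of i j] param_bound[OF t, of k l] by simp
  have m2: "norm (t$i$j * cnj (t$k$l) + t$i'$j' * cnj (t$k'$l')) \<le> 1/8" for i j k l i' j' k' l'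
    using m[of i j k l] m[of i' j' k' l'] norm_triangle_ineq[of "t$i$j * cnj (t$k$l)" "t$i'$j' * cnj (t$k'$l')"] by linarith
  define x where "x = t$1$1 * cnj (t$1$1) + t$1$2 * cnj (t$2$1)"
  define y where "y = t$2$1 * cnj (t$1$2) + t$2$2 * cnj (t$2$2)"
  define u where "u = t$1$1 * cnj (t$1$2) + t$1$2 * cnj (t$2$2)"
  define v where "v = t$2$1 * cnj (t$1$1) + t$2$2 * cnj (t$2$1)"
  have b: "cmod x \<le> 1/8" "cmod y \<le> 1/8" "cmod u \<le> 1/8" "cmod v \<le> 1/8"
    unfolding x_def y_def u_def v_def by (rule m2)+
  assume "(1 - t$1$1 * cnj (t$1$1) - t$1$2 * cnj (t$2$1)) * (1 - t$2$1 * cnj (t$1$2) - t$2$2 * cnj (t$2$2)) 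
    - (t$1$1 * cnj (t$1$2) + t$1$2 * cnj (t$2$2)) * (t$2$1 * cnj (t$1$1) + t$2$2 * cnj (t$2$1)) = 0"
  then have "(1 - x) * (1 - y) = u * v" unfolding x_def y_def u_def v_def by (simp add: algebra_simps)
  then have "1 = x + y + u * v - x * y" by (simp add: algebra_simps)
  then have "1 = cmod (x + y + u * v - x * y)" by (metis norm_one)
  also have "\<dots> \<le> cmod x + cmod y + cmod u * cmod v + cmod x * cmod y"
    unfolding norm_mult[symmetric] 
    using norm_triangle_ineq4[of "x + y + u * v" "x * y"] norm_triangle_ineq[of "x + y" "u * v"] norm_triangle_ineq[of x y] by linarith
  also have "\<dots> \<le> 1/8 + 1/8 + 1/8 * (1/8) + 1/8 * (1/8)"
    using b by (intro add_mono mult_mono) auto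
  finally show False by simp
qed

lemma covector_single: "covector f [v] = f v"
  by (auto simp: covector_def)

lemma pq_covectors_11: assumes "covector f \<in> set P" "covector g \<in> set P"
  shows "bicovector (\<lambda>v w. k * (f v * cnj (g w) - f w * cnj (g v))) \<in> pq_covectors P 1 1"
proof -
  have "(\<lambda>vs. k * wedge_list ([covector f] @ map conj_cov [covector g]) vs) \<in> pq_covectors P 1 1"
    by (rule pq_covectors_single) (use assms in auto)
  also have "wedge_list ([covector f] @ map conj_cov [covector g]) = bicovector (\<lambda>v w. f v * cnj (g w) - f w * cnj (g v))"
    using wedge_list_covectors[of "covector f" "conj_cov (covector g)"] by (simp add: covector_eq_0 conj_cov_def covector_single)
  also have "(\<lambda>vs. k * bicovector (\<lambda>v w. f v * cnj (g w) - f w * cnj (g v)) vs) = bicovector (\<lambda>v w. k * (f v * cnj (g w) - f w * cnj (g v)))"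
    by (auto simp: bicovector_def split: list.splits)
  finally show ?thesis .
qed

lemma pq_covectors_20: assumes "covector f \<in> set P" "covector g \<in> set P"
  shows "bicovector (\<lambda>v w. k * (f v * g w - f w * g v)) \<in> pq_covectors P 2 0"
proof -
  have "(\<lambda>vs. k * wedge_list ([covector f, covector g] @ map conj_cov []) vs) \<in> pq_covectors P 2 0"
    by (rule pq_covectors_single) (use assms in auto)
  also have "wedge_list ([covector f, covector g] @ map conj_cov []) = bicovector (\<lambda>v w. f v * g w - f w * g v)"
    using wedge_list_covectors[of "covector f" "covector g"] by (simp add: covector_eq_0  covector_single)
  also have "(\<lambda>vs. k * bicovector (\<lambda>v w. f v * g w - f w * g v) vs) = bicovector (\<lambda>v w. k * (f v * g w - f w * g v))"
    by (auto simp: bicovector_def split: list.splits)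
  finally show ?thesis .
qed

lemma pq_covectors_zero: "(\<lambda>vs. 0) \<in> pq_covectors P p q"
  unfolding pq_covectors_def by (auto intro!: exI[of _ "\<lambda>_ _. 0"])

lemma bicovector_add: "bicovector F vs + bicovector G vs = bicovector (\<lambda>v w. F v w + G v w) vs" by (auto simp: bicovector_def split: list.splits)

lemma gamma_t_integrable:
  assumes t: "t \<in> ball 0 (1/4)"
  shows "\<exists>A\<in>pq_covectors (coframe_at (iwasawa_deform t) z) 2 0.
        \<exists>B\<in>pq_covectors (coframe_at (iwasawa_deform t) z) 1 1. ext_deriv (\<gamma>\<^sub>t t) z = (\<lambda>vs. A vs + B vs)"
proof -
  define a where "a = (\<lambda>v::complex^3. v$1 + t$1$1 * cnj (v$1) + t$1$2 * cnj (v$2))"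
  define b where "b = (\<lambda>v::complex^3. v$2 + t$2$1 * cnj (v$1) + t$2$2 * cnj (v$2))"
  let ?P = "coframe_at (iwasawa_deform t) z"
  have m: "covector a \<in> set ?P" "covector b \<in> set ?P"
    by (auto simp: coframe_at_def iwasawa_deform_def alpha_t_eq beta_t_eq a_def b_def)
  define n where "n = (1 - t$1$1 * cnj (t$1$1) - t$1$2 * cnj (t$2$1)) * (1 - t$2$1 * cnj (t$1$2) - t$2$2 * cnj (t$2$2)) 
    - (t$1$1 * cnj (t$1$2) + t$1$2 * cnj (t$2$2)) * (t$2$1 * cnj (t$1$1) + t$2$2 * cnj (t$2$1))"
  have n0: "n \<noteq> 0" using param_det_nonzero[OF t] by (simp add: n_def)
  define D where "D = kuranishi_D t"
  define A where "A = bicovector (\<lambda>v w. ((D * cnj D - 1)/n) * (a v * b w - a w * b v))"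
  define B1 where "B1 = bicovector (\<lambda>v w. ((t$2$1 + D * cnj (t$2$1))/n) * (a v * cnj (a w) - a w * cnj (a v)))"
  define B2 where "B2 = bicovector (\<lambda>v w. ((t$2$2 - D * cnj (t$1$1))/n) * (a v * cnj (b w) - a w * cnj (b v)))"
  define B3 where "B3 = bicovector (\<lambda>v w. ((D * cnj (t$2$2) - t$1$1)/n) * (b v * cnj (a w) - b w * cnj (a v)))"
  define B4 where "B4 = bicovector (\<lambda>v w. (-(t$1$2 + D * cnj (t$1$2))/n) * (b v * cnj (b w) - b w * cnj (b v)))"
  have A: "A \<in> pq_covectors ?P 2 0" unfolding A_def by (rule pq_covectors_20) fact+
  have B: "(\<lambda>vs. (B1 vs + B2 vs) + (B3 vs + B4 vs)) \<in> pq_covectors ?P 1 1" unfolding B1_def B2_def B3_def B4_def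
    by (intro pq_covectors_add pq_covectors_11 m)
  have e: "- (v$1 * w$2 - w$1 * v$2) + D * cnj (v$1 * w$2 - w$1 * v$2) = 
     (D * cnj D - 1)/n * (a v * b w - a w * b v) + 
     ((t$2$1 + D * cnj (t$2$1))/n * (a v * cnj (a w) - a w * cnj (a v)) + (t$2$2 - D * cnj (t$1$1))/n * (a v * cnj (b w) - a w * cnj (b v)) 
     + ((D * cnj (t$2$2) - t$1$1)/n * (b v * cnj (a w) - b w * cnj (a v)) + (-(t$1$2 + D * cnj (t$1$2))/n) * (b v * cnj (b w) - b w * cnj (b v))))"
    (is "?l = ?r") for v w
  proof -
    have "n * ?l = (D * cnj D - 1) * (a v * b w - a w * b v) + (t$2$1 + D * cnj (t$2$1)) * (a v * cnj (a w) - a w * cnj (a v)) + (t$2$2 - D * cnj (t$1$1)) * (a v * cnj (b w) - a w * cnj (b v)) 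
     + (D * cnj (t$2$2) - t$1$1) * (b v * cnj (a w) - b w * cnj (a v)) - (t$1$2 + D * cnj (t$1$2)) * (b v * cnj (b w) - b w * cnj (b v))"
      unfolding n_def D_def kuranishi_D_def complex_cnj_diff complex_cnj_mult
      by (rule torsion_identity[of "a v" "v$1" "t$1$1" "cnj (v$1)" "t$1$2" "cnj (v$2)" "b v" "v$2" "t$2$1" "t$2$2"
            "cnj (a v)" "cnj (t$1$1)" "cnj (t$1$2)" "cnj (b v)" "cnj (t$2$1)" "cnj (t$2$2)"
            "a w" "w$1" "cnj (w$1)" "cnj (w$2)" "b w" "w$2" "cnj (a w)" "cnj (b w)"])
         (simp_all add: a_def b_def)
    moreover have "n * ?r = (D * cnj D - 1) * (a v * b w - a w * b v) + (t$2$1 + D * cnj (t$2$1)) * (a v * cnj (a w) - a w * cnj (a v)) + (t$2$2 - D * cnj (t$1$1)) * (a v * cnj (b w) - a w * cnj (b v)) 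
     + (D * cnj (t$2$2) - t$1$1) * (b v * cnj (a w) - b w * cnj (a v)) - (t$1$2 + D * cnj (t$1$2)) * (b v * cnj (b w) - b w * cnj (b v))"
      using n0 by (simp add: distrib_left) algebra
    ultimately show ?thesis using n0 by (metis mult_left_cancel)
  qed
  have "ext_deriv (\<gamma>\<^sub>t t) z = (\<lambda>vs. A vs + ((B1 vs + B2 vs) + (B3 vs + B4 vs)))"
    unfolding ext_deriv_gamma_t A_def B1_def B2_def B3_def B4_def bicovector_add D_def[symmetric] e ..
  then show ?thesis by (intro bexI[OF _ A] bexI[OF _ B])
qed

lemma exists_kuranishi_base: "\<exists>\<Delta>. kuranishi_base \<Delta>"
proof -
  have "complex_structure (iwasawa_deform t)" if t: "t \<in> ball 0 (1/4)" for t
    unfolding complex_structure_def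
  proof (intro conjI ballI allI)
    show "set (coframe (iwasawa_deform t)) \<subseteq> smooth_forms (iwasawa_deform t) 1"
      using coframe_smooth_forms[of t] by (simp add: iwasawa_deform_def)
  next
    fix z show "bij_betw (\<lambda>v. map (\<lambda>\<phi>. \<phi> [v]) (coframe_at (iwasawa_deform t) z)) UNIV {ws. length ws = cdim (iwasawa_deform t)}"
      using coframe_bij[OF t] .
  next
    fix \<theta> z assume "\<theta> \<in> set (coframe (iwasawa_deform t))"
    then consider "\<theta> = \<alpha>\<^sub>t t" | "\<theta> = \<beta>\<^sub>t t" | "\<theta> = \<gamma>\<^sub>t t" by (auto simp: iwasawa_deform_def)
    then show "\<exists>A\<in>pq_covectors (coframe_at (iwasawa_deform t) z) 2 0.
        \<exists>B\<in>pq_covectors (coframe_at (iwasawa_deform t) z) 1 1. ext_deriv \<theta> z = (\<lambda>vs. A vs + B vs)"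
    proof cases
      case 1 then show ?thesis using ext_deriv_const[OF alpha_t_eq] pq_covectors_zero by (intro bexI[of _ "\<lambda>_. 0"]) auto
    next
      case 2 then show ?thesis using ext_deriv_const[OF beta_t_eq] pq_covectors_zero by (intro bexI[of _ "\<lambda>_. 0"]) auto
    next
      case 3 then show ?thesis using gamma_t_integrable[OF t] by simp
    qed
  qed
  then show ?thesis unfolding kuranishi_base_def 
    by (intro exI[of _ "ball 0 (1/4)"]) (auto intro!: exI[of _ "1/4"])
qed

end

theory Submission
  imports Defs
begin

text \<open>
  Positivity holds because \<open>\<omega>\<^sub>t(v, Jv)\<close> is twice the sum of the \<open>\<bar>\<phi>(v)\<bar>\<^sup>2\<close> over the coframe. On the closed
  forms \<open>\<alpha>\<^sub>t\<close>, \<open>\<beta>\<^sub>t\<close> and their conjugates, \<open>d\<gamma>\<^sub>t\<close> is a combination with constant coefficients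
  \<open>k\<^sub>1 \<alpha>\<^sub>t\<beta>\<^sub>t + k\<^sub>2 \<alpha>\<^sub>t\<alpha>\<^sub>t' + k\<^sub>3 \<alpha>\<^sub>t\<beta>\<^sub>t' + k\<^sub>4 \<beta>\<^sub>t\<alpha>\<^sub>t' + k\<^sub>5 \<beta>\<^sub>t\<beta>\<^sub>t'\<close>, where primes denote conjugates. Hence
  \<open>d(\<omega>\<^sub>t\<^sup>2)\<close> is the sum of \<open>2(k\<^sub>2 + k\<^sub>5) \<alpha>\<^sub>t\<beta>\<^sub>t\<alpha>\<^sub>t'\<beta>\<^sub>t'\<gamma>\<^sub>t'\<close> and of its conjugate. The former is the part of type
  (2,3), and it is closed, because \<open>\<alpha>\<^sub>t\<beta>\<^sub>t\<alpha>\<^sub>t'\<beta>\<^sub>t' d\<gamma>\<^sub>t'\<close> has six factors among four 1-forms.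
\<close>

section \<open>The wedge product\<close>

lemma wedge_Nil: "(A \<and>\<^sub>w B) [] = A [] * B []"
  by (simp add: wedge_def)

text \<open>
  This recursion on the list of arguments reduces associativity, alternation and the Leibniz rule
  to inductions on lists in which the combinatorics of shuffles no longer appears.
\<close>

lemma wedge_Cons:
  "(A \<and>\<^sub>w B) (v # vs) =
     ((\<lambda>ws. A (v # ws)) \<and>\<^sub>w B) vs + ((\<lambda>ws. (- 1) ^ length ws * A ws) \<and>\<^sub>w (\<lambda>ws. B (v # ws))) vs"
proof -
  define n where "n = length vs"
  define inv where "inv m S = {(i, j). i \<in> S \<and> j \<in> {..<m} - S \<and> j < i}" for m and S :: "nat set"
  define f where "f S = (- 1) ^ card (inv (Suc n) S) * A (nths (v # vs) S) * B (nths (v # vs) (- S))" for S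
  have inj: "inj_on (image Suc) X" for X :: "nat set set"
    by (auto simp: inj_on_def inj_image_eq_iff)
  have P: "Pow {..<Suc n} = (insert 0 \<circ> image Suc) ` Pow {..<n} \<union> image Suc ` Pow {..<n}"
    unfolding lessThan_Suc_eq_insert_0 Pow_insert image_Pow_surj[OF refl, symmetric] image_comp
    by (auto simp: image_image)
  have shift: "{j. Suc j \<in> insert 0 (Suc ` T)} = T" "{j. Suc j \<in> Suc ` T} = T"
     "{j. Suc j \<in> - insert 0 (Suc ` T)} = - T" "{j. Suc j \<in> - Suc ` T} = - T"
     "{j. Suc j \<notin> insert 0 (Suc ` T)} = - T" "{j. Suc j \<notin> Suc ` T} = - T" for T :: "nat set"
    by auto
  have fin: "finite (inv m T)" if "T \<subseteq> {..<n}" for m T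
    by (rule finite_subset[of _ "{..<n} \<times> {..<m}"]) (use that in \<open>auto simp: inv_def\<close>)
  have inv0: "inv (Suc n) (insert 0 (Suc ` T)) = map_prod Suc Suc ` inv n T" for T
    by (auto simp: inv_def image_iff less_Suc_eq_0_disj)
  have inv1: "inv (Suc n) (Suc ` T) = map_prod Suc Suc ` inv n T \<union> (\<lambda>i. (Suc i, 0)) ` T" for T
    by (auto simp: inv_def image_iff less_Suc_eq_0_disj)
  have c0: "card (inv (Suc n) (insert 0 (Suc ` T))) = card (inv n T)" for T
    unfolding inv0 by (rule card_image) (auto simp: inj_on_def)
  have c1: "card (inv (Suc n) (Suc ` T)) = card (inv n T) + length (nths vs T)" if "T \<subseteq> {..<n}" for T
  proof -
    have "card (inv (Suc n) (Suc ` T)) = card (map_prod Suc Suc ` inv n T) + card ((\<lambda>i. (Suc i, 0::nat)) ` T)"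
      unfolding inv1 using fin[OF that] finite_subset[OF that] by (intro card_Un_disjoint) auto
    also have "card (map_prod Suc Suc ` inv n T) = card (inv n T)"
      by (rule card_image) (auto simp: inj_on_def)
    also have "card ((\<lambda>i. (Suc i, 0::nat)) ` T) = card T"
      by (rule card_image) (auto simp: inj_on_def)
    also have "T = {i. i < length vs \<and> i \<in> T}"
      using that by (auto simp: n_def)
    then have "card T = length (nths vs T)"
      by (metis length_nths)
    finally show ?thesis .
  qed
  have w: "(F \<and>\<^sub>w G) us = (\<Sum>S\<in>Pow {..<length us}.
      (- 1) ^ card (inv (length us) S) * F (nths us S) * G (nths us (- S)))"
    for F G :: "'a multicovector" and us
    by (simp only: wedge_def inv_def)
  have "(A \<and>\<^sub>w B) (v # vs) = sum f (Pow {..<Suc n})"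
    by (simp add: w f_def n_def)
  also have "\<dots> = sum f ((insert 0 \<circ> image Suc) ` Pow {..<n}) + sum f (image Suc ` Pow {..<n})"
    unfolding P by (rule sum.union_disjoint) auto
  also have "sum f ((insert 0 \<circ> image Suc) ` Pow {..<n}) = (\<Sum>T\<in>Pow {..<n}. f (insert 0 (Suc ` T)))"
    by (subst sum.reindex) (auto simp: inj_on_def)
  also have "sum f (image Suc ` Pow {..<n}) = (\<Sum>T\<in>Pow {..<n}. f (Suc ` T))"
    by (subst sum.reindex) (auto simp: inj)
  also have "(\<Sum>T\<in>Pow {..<n}. f (insert 0 (Suc ` T))) = ((\<lambda>ws. A (v # ws)) \<and>\<^sub>w B) vs"
    unfolding w n_def[symmetric] f_def
    by (intro sum.cong refl) (simp add: c0 nths_Cons shift)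
  also have "(\<Sum>T\<in>Pow {..<n}. f (Suc ` T)) = ((\<lambda>ws. (- 1) ^ length ws * A ws) \<and>\<^sub>w (\<lambda>ws. B (v # ws))) vs"
    unfolding w n_def[symmetric] f_def
    by (intro sum.cong refl) (simp add: c1 nths_Cons shift power_add)
  finally show ?thesis .
qed

lemma wedge_add_left: "(\<lambda>vs. A vs + B vs) \<and>\<^sub>w C = (\<lambda>vs. (A \<and>\<^sub>w C) vs + (B \<and>\<^sub>w C) vs)"
  and wedge_add_right: "C \<and>\<^sub>w (\<lambda>vs. A vs + B vs) = (\<lambda>vs. (C \<and>\<^sub>w A) vs + (C \<and>\<^sub>w B) vs)"
  and wedge_diff_left: "(\<lambda>vs. A vs - B vs) \<and>\<^sub>w C = (\<lambda>vs. (A \<and>\<^sub>w C) vs - (B \<and>\<^sub>w C) vs)"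
  and wedge_diff_right: "C \<and>\<^sub>w (\<lambda>vs. A vs - B vs) = (\<lambda>vs. (C \<and>\<^sub>w A) vs - (C \<and>\<^sub>w B) vs)"
  and wedge_minus_left: "(\<lambda>vs. - A vs) \<and>\<^sub>w C = (\<lambda>vs. - (A \<and>\<^sub>w C) vs)"
  and wedge_minus_right: "C \<and>\<^sub>w (\<lambda>vs. - A vs) = (\<lambda>vs. - (C \<and>\<^sub>w A) vs)"
  and wedge_mult_left: "(\<lambda>vs. k * A vs) \<and>\<^sub>w C = (\<lambda>vs. k * (A \<and>\<^sub>w C) vs)"
  and wedge_mult_right: "C \<and>\<^sub>w (\<lambda>vs. k * A vs) = (\<lambda>vs. k * (C \<and>\<^sub>w A) vs)"
  and wedge_zero_left: "(\<lambda>vs. 0) \<and>\<^sub>w C = (\<lambda>vs. 0)"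
  and wedge_zero_right: "C \<and>\<^sub>w (\<lambda>vs. 0) = (\<lambda>vs. 0)"
  by (simp_all add: wedge_def fun_eq_iff distrib_left distrib_right right_diff_distrib left_diff_distrib
      sum.distrib sum_subtractf sum_negf sum_distrib_left mult_ac)

lemmas wedge_bilinear = wedge_add_left wedge_add_right wedge_diff_left wedge_diff_right
  wedge_minus_left wedge_minus_right wedge_mult_left wedge_mult_right wedge_zero_left wedge_zero_right

text \<open>Complementary sublists have lengths adding up to that of the list, so the sign splits
  over every shuffle. Thus the grading involution respects products, as is needed when
  \<open>wedge_Cons\<close> is applied to a factor that is itself a product.\<close>

lemma wedge_grading:
  "(\<lambda>ws. (- 1) ^ length ws * (A \<and>\<^sub>w B) ws) =
     (\<lambda>ws. (- 1) ^ length ws * A ws) \<and>\<^sub>w (\<lambda>ws. (- 1) ^ length ws * B ws)"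
proof
  fix vs :: "'a list"
  have sign: "(- 1 :: complex) ^ length vs = (- 1) ^ length (nths vs S) * (- 1) ^ length (nths vs (- S))" for S
    by (simp flip: power_add length_nths_compl[of vs S])
  show "(- 1) ^ length vs * (A \<and>\<^sub>w B) vs =
      ((\<lambda>ws. (- 1) ^ length ws * A ws) \<and>\<^sub>w (\<lambda>ws. (- 1) ^ length ws * B ws)) vs"
    unfolding wedge_def sum_distrib_left
    by (intro sum.cong refl) (subst sign, simp only: mult_ac)
qed

text \<open>Expansion by \<open>wedge_Cons\<close> splits either side into the same three terms,
  according to whether the first argument goes to \<open>A\<close>, \<open>B\<close> or
  \<open>C\<close>. Each term has changed factors, so the induction varies all three.\<close>

lemma wedge_assoc: "(A \<and>\<^sub>w B) \<and>\<^sub>w C = A \<and>\<^sub>w B \<and>\<^sub>w C"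
proof
  fix vs show "((A \<and>\<^sub>w B) \<and>\<^sub>w C) vs = (A \<and>\<^sub>w B \<and>\<^sub>w C) vs"
    by (induction vs arbitrary: A B C) (simp_all add: wedge_Nil wedge_Cons wedge_bilinear wedge_grading)
qed

lemma wedge_one_cov: "A \<and>\<^sub>w one_cov = A"
proof
  fix vs
  have [simp]: "(\<lambda>ws. one_cov (v # ws)) = (\<lambda>ws. 0)" for v :: 'a
    by (simp add: one_cov_def)
  show "(A \<and>\<^sub>w one_cov) vs = A vs"
    by (induction vs arbitrary: A) (simp_all add: wedge_Nil wedge_Cons wedge_zero_right, simp add: one_cov_def)
qed

lemma wedge_map: "(A \<and>\<^sub>w B) (map f vs) = ((\<lambda>ws. A (map f ws)) \<and>\<^sub>w (\<lambda>ws. B (map f ws))) vs"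
  by (simp add: wedge_def nths_map)

lemma conj_cov_wedge: "conj_cov (A \<and>\<^sub>w B) = conj_cov A \<and>\<^sub>w conj_cov B"
  by (simp add: wedge_def conj_cov_def fun_eq_iff)

lemma covector_wedge_covector: "covector f \<and>\<^sub>w covector g = bicovector (\<lambda>v w. f v * g w - f w * g v)"
  using wedge_list_covectors[of "covector f" "covector g"]
  by (simp add: wedge_list_def wedge_one_cov covector_eq_0 covector_single)

lemma wedge_commute: "covector f \<and>\<^sub>w covector g = (\<lambda>vs. - (covector g \<and>\<^sub>w covector f) vs)"
  by (simp add: covector_wedge_covector bicovector_def fun_eq_iff split: list.split)

text \<open>Associativity carries the exchange of two covectors into the interior of a right-nested
  product, where monomials will be sorted.\<close>

lemma wedge_left_commute: "covector f \<and>\<^sub>w covector g \<and>\<^sub>w A = (\<lambda>vs. - (covector g \<and>\<^sub>w covector f \<and>\<^sub>w A) vs)"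
  using wedge_assoc[of "covector f" "covector g" A] wedge_assoc[of "covector g" "covector f" A]
  by (simp add: wedge_commute[of f g] wedge_minus_left)

lemma wedge_same: "covector f \<and>\<^sub>w covector f = (\<lambda>vs. 0)"
  by (simp add: covector_wedge_covector bicovector_def fun_eq_iff split: list.split)

lemma wedge_left_same: "covector f \<and>\<^sub>w covector f \<and>\<^sub>w A = (\<lambda>vs. 0)"
  using wedge_assoc[of "covector f" "covector f" A] by (simp add: wedge_same wedge_zero_left)

section \<open>Multilinearity and alternation of wedge products\<close>

text \<open>Splitting the list around the varying argument replaces the list update of
  \<open>alternating_def\<close> and suits recursion on lists. On lists of the wrong length the map
  is zero, hence linear.\<close>

lemma alternating_linear: "alternating k A \<Longrightarrow> linear (\<lambda>v. A (xs @ v # ys))"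
proof (cases "length (xs @ 0 # ys) = k")
  case True
  moreover assume "alternating k A"
  moreover have "length xs < length (xs @ 0 # ys)" by simp
  ultimately have "linear (\<lambda>v. A ((xs @ 0 # ys)[length xs := v]))"
    unfolding alternating_def by blast
  then show ?thesis by simp
next
  case False
  moreover assume "alternating k A"
  ultimately have "(\<lambda>v. A (xs @ v # ys)) = (\<lambda>v. 0)"
    unfolding alternating_def by auto
  then show ?thesis by (simp add: linear_zero)
qed

text \<open>Polarization: the value with \<open>v + w\<close> in both adjacent slots is zero and
  expands into four terms, two of which vanish.\<close>

lemma alternating_swap:
  assumes "alternating k A"
  shows "A (xs @ v # w # ys) = - A (xs @ w # v # ys)"
proof -
  note l = alternating_linear[OF assms]
  have z: "A (xs @ u # u # ys) = 0" for u
  proof -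
    have "\<not> distinct (xs @ u # u # ys)" by simp
    then show ?thesis using assms unfolding alternating_def by blast
  qed
  have "A (xs @ (v + w) # (v + w) # ys) = A (xs @ v # (v + w) # ys) + A (xs @ w # (v + w) # ys)"
    by (rule linear_add[OF l])
  also have "A (xs @ v # (v + w) # ys) = A (xs @ v # v # ys) + A (xs @ v # w # ys)"
    using linear_add[OF l[of "xs @ [v]" ys]] by simp
  also have "A (xs @ w # (v + w) # ys) = A (xs @ w # v # ys) + A (xs @ w # w # ys)"
    using linear_add[OF l[of "xs @ [w]" ys]] by simp
  finally show ?thesis by (simp add: z eq_neg_iff_add_eq_0)
qed

text \<open>Adjacent exchanges bring two equal arguments together, and there the value equals its
  own negative.\<close>

lemma alternatingI:
  assumes deg: "\<And>vs. length vs \<noteq> k \<Longrightarrow> A vs = 0"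
    and lin: "\<And>xs ys. linear (\<lambda>v. A (xs @ v # ys))"
    and swap: "\<And>xs v w ys. A (xs @ v # w # ys) = - A (xs @ w # v # ys)"
  shows "alternating k A"
  unfolding alternating_def
proof (intro conjI allI impI)
  fix vs :: "'a list" and i assume "length vs = k" "i < k"
  then show "linear (\<lambda>v. A (vs[i := v]))"
    by (simp add: upd_conv_take_nth_drop lin)
next
  fix vs :: "'a list" assume "\<not> distinct vs"
  then obtain xs y ys zs where vs: "vs = xs @ [y] @ ys @ [y] @ zs"
    using not_distinct_decomp by blast
  \<comment> \<open>The prefix varies because exchanging \<open>y\<close> with \<open>u\<close>
    moves \<open>u\<close> into it.\<close>
  have "A (xs @ y # ys @ y # zs) = 0" for xs
  proof (induction ys arbitrary: xs)
    case Nil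
    show ?case using swap[of xs y y zs] by simp
  next
    case (Cons u us)
    show ?case using swap[of xs y u "us @ y # zs"] Cons[of "xs @ [u]"] by simp
  qed
  then show "A vs = 0" by (simp add: vs)
qed (rule deg)

text \<open>The hypotheses fix no degree, so they pass to the contracted and graded factors that
  \<open>wedge_Cons\<close> produces.\<close>

lemma linear_wedge:
  assumes "\<And>xs ys. linear (\<lambda>v. A (xs @ v # ys))" "\<And>xs ys. linear (\<lambda>v. B (xs @ v # ys))"
  shows "linear (\<lambda>v. (A \<and>\<^sub>w B) (xs @ v # ys))"
  using assms
proof (induction xs arbitrary: A B)
  case Nil
  have l: "linear (\<lambda>v. (F v \<and>\<^sub>w G) ys)" "linear (\<lambda>v. (G \<and>\<^sub>w F v) ys)"
    if "\<And>ws. linear (\<lambda>v. F v ws)" for F and G :: "'a multicovector"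
    using that unfolding wedge_def linear_iff
    by (simp_all add: sum.distrib scaleR_sum_right distrib_left distrib_right)
  show ?case
    unfolding append_Nil wedge_Cons
    using Nil(1)[of "[]"] Nil(2)[of "[]"] by (intro linear_compose_add l) simp_all
next
  case (Cons x xs)
  have "linear (\<lambda>v. (-1) ^ length (xs @ v # ys) * A (xs @ v # ys))" for xs ys
    using Cons.prems(1)[of xs ys] by (simp add: linear_iff distrib_left)
  then show ?case
    unfolding append_Cons wedge_Cons
    using Cons.prems(1)[of "x # _"] Cons.prems(2)[of "x # _"]
    by (intro linear_compose_add Cons.IH Cons.prems) simp_all
qed

text \<open>If the exchange is in the first two slots, two steps of \<open>wedge_Cons\<close> give
  four terms. Those sending both arguments to one factor change sign by hypothesis; the two mixed
  terms carry opposite grading signs and are interchanged.\<close>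

lemma wedge_swap:
  assumes "\<And>xs v w ys. A (xs @ v # w # ys) = - A (xs @ w # v # ys)"
    and "\<And>xs v w ys. B (xs @ v # w # ys) = - B (xs @ w # v # ys)"
  shows "(A \<and>\<^sub>w B) (xs @ v # w # ys) = - (A \<and>\<^sub>w B) (xs @ w # v # ys)"
  using assms
proof (induction xs arbitrary: A B)
  case Nil
  have e: "(\<lambda>ws. A (v # w # ws)) = (\<lambda>ws. - A (w # v # ws))"
    "(\<lambda>ws. B (v # w # ws)) = (\<lambda>ws. - B (w # v # ws))"
    using Nil(1)[of "[]" v w] Nil(2)[of "[]" v w] by simp_all
  show ?case by (simp add: wedge_Cons wedge_bilinear e)
next
  case (Cons x xs)
  have A: "A (x # xs @ v # w # ys) = - A (x # xs @ w # v # ys)" for xs v w ys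
    using Cons.prems(1)[of "x # xs" v w ys] by simp
  have B: "B (x # xs @ v # w # ys) = - B (x # xs @ w # v # ys)" for xs v w ys
    using Cons.prems(2)[of "x # xs" v w ys] by simp
  \<comment> \<open>The grading sign depends on the length alone, which the exchange
    preserves.\<close>
  have sA: "(-1) ^ length (xs @ v # w # ys) * A (xs @ v # w # ys) =
      - ((-1) ^ length (xs @ w # v # ys) * A (xs @ w # v # ys))"
    for xs v w ys
    by (subst Cons.prems(1)) simp
  show ?case
    unfolding append_Cons wedge_Cons minus_add_distrib
    by (intro arg_cong2[where f = "(+)"] Cons.IH A B sA Cons.prems(2))
qed

lemma alternating_wedge:
  assumes "alternating p A" "alternating q B"
  shows "alternating (p + q) (A \<and>\<^sub>w B)"
proof (rule alternatingI)
  show "(A \<and>\<^sub>w B) vs = 0" if "length vs \<noteq> p + q" for vs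
    by (rule wedge_degree[OF _ _ that]) (use assms in \<open>auto simp: alternating_def\<close>)
next
  show "linear (\<lambda>v. (A \<and>\<^sub>w B) (xs @ v # ys))" for xs ys
    by (intro linear_wedge alternating_linear[OF assms(1)] alternating_linear[OF assms(2)])
next
  show "(A \<and>\<^sub>w B) (xs @ v # w # ys) = - (A \<and>\<^sub>w B) (xs @ w # v # ys)" for xs v w ys
    by (intro wedge_swap alternating_swap[OF assms(1)] alternating_swap[OF assms(2)])
qed

section \<open>Smooth functions and the exterior derivative\<close>

text \<open>The recursive definition does not state this inclusion. The product rule needs it, since
  each of its terms keeps one undifferentiated factor.\<close>

lemma times_cont_differentiable_Suc_imp:
  "times_cont_differentiable (Suc k) f \<Longrightarrow> times_cont_differentiable k f"
proof (induction k arbitrary: f)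
  case 0
  then show ?case by (simp add: differentiable_imp_continuous_on)
next
  case (Suc k)
  from Suc.prems show ?case
    unfolding times_cont_differentiable.simps(2)[of "Suc k"] times_cont_differentiable.simps(2)[of k f]
    using Suc.IH by blast
qed

lemma smooth_imp_differentiable: "smooth f \<Longrightarrow> f differentiable at x"
  unfolding smooth_def by (drule spec[of _ "Suc 0"]) (simp add: differentiable_on_def)

lemma frechet_derivative_add:
  "f differentiable at x \<Longrightarrow> g differentiable at x \<Longrightarrow>
    frechet_derivative (\<lambda>x. f x + g x) (at x) =
      (\<lambda>v. frechet_derivative f (at x) v + frechet_derivative g (at x) v)"
  by (rule frechet_derivative_at[symmetric])
    (rule has_derivative_add; simp add: frechet_derivative_works[symmetric])

lemma frechet_derivative_mult:
  fixes f g :: "'a::real_normed_vector \<Rightarrow> 'b::real_normed_algebra"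
  shows "f differentiable at x \<Longrightarrow> g differentiable at x \<Longrightarrow>
    frechet_derivative (\<lambda>x. f x * g x) (at x) =
      (\<lambda>v. f x * frechet_derivative g (at x) v + frechet_derivative f (at x) v * g x)"
  by (rule frechet_derivative_at[symmetric])
    (rule has_derivative_mult; simp add: frechet_derivative_works[symmetric])

lemma frechet_derivative_bounded_linear:
  "bounded_linear L \<Longrightarrow> f differentiable at x \<Longrightarrow>
    frechet_derivative (\<lambda>x. L (f x)) (at x) = (\<lambda>v. L (frechet_derivative f (at x) v))"
  by (rule frechet_derivative_at[symmetric])
    (rule bounded_linear.has_derivative; simp add: frechet_derivative_works[symmetric])

lemma frechet_derivative_sum:
  "(\<And>i. i \<in> I \<Longrightarrow> f i differentiable at x) \<Longrightarrow>
    frechet_derivative (\<lambda>x. \<Sum>i\<in>I. f i x) (at x) = (\<lambda>v. \<Sum>i\<in>I. frechet_derivative (f i) (at x) v)"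
  by (rule frechet_derivative_at[symmetric])
    (rule has_derivative_sum; simp add: frechet_derivative_works[symmetric])

lemma times_cont_differentiable_add:
  "times_cont_differentiable k f \<Longrightarrow> times_cont_differentiable k g \<Longrightarrow>
    times_cont_differentiable k (\<lambda>x. f x + g x)"
proof (induction k arbitrary: f g)
  case (Suc k)
  then show ?case
    by (simp add: frechet_derivative_add differentiable_on_def)
qed (simp add: continuous_on_add)

lemma times_cont_differentiable_mult:
  fixes f g :: "'a::real_normed_vector \<Rightarrow> 'b::real_normed_algebra"
  shows "times_cont_differentiable k f \<Longrightarrow> times_cont_differentiable k g \<Longrightarrow>
    times_cont_differentiable k (\<lambda>x. f x * g x)"
proof (induction k arbitrary: f g)
  case (Suc k)
  then have "times_cont_differentiable k f" "times_cont_differentiable k g"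
    by (auto intro: times_cont_differentiable_Suc_imp simp del: times_cont_differentiable.simps)
  with Suc show ?case
    by (simp add: frechet_derivative_mult differentiable_on_def times_cont_differentiable_add)
qed (simp add: continuous_on_mult)

lemma times_cont_differentiable_bounded_linear:
  assumes "bounded_linear L"
  shows "times_cont_differentiable k f \<Longrightarrow> times_cont_differentiable k (\<lambda>x. L (f x))"
proof (induction k arbitrary: f)
  case 0
  then show ?case
    using bounded_linear.continuous_on[OF assms] by auto
next
  case (Suc k)
  then have d: "f differentiable at x" for x by (simp add: differentiable_on_def)
  have "(\<lambda>x. L (f x)) differentiable_on UNIV"
    using differentiable_compose[OF bounded_linear_imp_differentiable[OF assms] d]
    by (simp add: differentiable_on_def)
  with Suc d show ?case
    by (simp add: frechet_derivative_bounded_linear[OF assms])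
qed

lemma smooth_const: "smooth (\<lambda>x. c)"
  by (simp add: smooth_def times_cont_differentiable_const)

lemma smooth_add: "smooth f \<Longrightarrow> smooth g \<Longrightarrow> smooth (\<lambda>x. f x + g x)"
  by (simp add: smooth_def times_cont_differentiable_add)

lemma smooth_mult:
  fixes f g :: "'a::real_normed_vector \<Rightarrow> 'b::real_normed_algebra"
  shows "smooth f \<Longrightarrow> smooth g \<Longrightarrow> smooth (\<lambda>x. f x * g x)"
  by (simp add: smooth_def times_cont_differentiable_mult)

lemma smooth_cnj: "smooth f \<Longrightarrow> smooth (\<lambda>x. cnj (f x))"
  by (simp add: smooth_def times_cont_differentiable_bounded_linear bounded_linear_cnj)

lemma smooth_sum: "(\<And>i. i \<in> I \<Longrightarrow> smooth (f i)) \<Longrightarrow> smooth (\<lambda>x. \<Sum>i\<in>I. f i x)"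
  by (induction I rule: infinite_finite_induct) (simp_all add: smooth_const smooth_add)

lemma smooth_wedge:
  "(\<And>ws. smooth (\<lambda>z. A z ws)) \<Longrightarrow> (\<And>ws. smooth (\<lambda>z. B z ws)) \<Longrightarrow> smooth (\<lambda>z. (A z \<and>\<^sub>w B z) vs)"
  unfolding wedge_def by (intro smooth_sum smooth_mult smooth_const)

lemma frechet_derivative_wedge:
  assumes A: "\<And>ws. (\<lambda>x. A x ws) differentiable at z" and B: "\<And>ws. (\<lambda>x. B x ws) differentiable at z"
  shows "frechet_derivative (\<lambda>x. (A x \<and>\<^sub>w B x) vs) (at z) u =
    ((\<lambda>ws. frechet_derivative (\<lambda>x. A x ws) (at z) u) \<and>\<^sub>w B z) vs +
    (A z \<and>\<^sub>w (\<lambda>ws. frechet_derivative (\<lambda>x. B x ws) (at z) u)) vs"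
  unfolding wedge_def
  by (simp add: frechet_derivative_sum frechet_derivative_mult A B sum.distrib)

section \<open>Cartan's formula and the graded Leibniz rule\<close>

lemma ext_deriv_Nil: "ext_deriv \<omega> z [] = 0"
  by (simp add: ext_deriv_def)

text \<open>This is Cartan's formula for the constant vector field \<open>v\<close>: the summand
  with index 0 is the Lie derivative, and the others form the derivative of the contraction with
  shifted signs.\<close>

lemma ext_deriv_Cons:
  "ext_deriv \<omega> z (v # vs) =
     frechet_derivative (\<lambda>x. \<omega> x vs) (at z) v - ext_deriv (\<lambda>x ws. \<omega> x (v # ws)) z vs"
  by (simp add: ext_deriv_def sum.lessThan_Suc_shift sum_negf del: sum.lessThan_Suc)

lemma ext_deriv_add:
  assumes "\<And>ws. (\<lambda>x. A x ws) differentiable at z" and "\<And>ws. (\<lambda>x. B x ws) differentiable at z"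
  shows "ext_deriv (\<lambda>x ws. A x ws + B x ws) z = (\<lambda>vs. ext_deriv A z vs + ext_deriv B z vs)"
  using assms by (simp add: ext_deriv_def frechet_derivative_add sum.distrib distrib_left fun_eq_iff)

lemma ext_deriv_mult:
  assumes "\<And>ws. (\<lambda>x. A x ws) differentiable at z"
  shows "ext_deriv (\<lambda>x ws. k * A x ws) z = (\<lambda>vs. k * ext_deriv A z vs)"
  using assms
  by (simp add: ext_deriv_def frechet_derivative_bounded_linear[OF bounded_linear_mult_right]
      sum_distrib_left mult_ac fun_eq_iff)

lemma ext_deriv_conj_cov:
  assumes "\<And>ws. (\<lambda>x. A x ws) differentiable at z"
  shows "ext_deriv (\<lambda>x. conj_cov (A x)) z = conj_cov (ext_deriv A z)"
  using assms
  by (simp add: ext_deriv_def conj_cov_def frechet_derivative_bounded_linear[OF bounded_linear_cnj] fun_eq_iff)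

text \<open>The exterior derivative raises the degree by one, so it anticommutes with the grading
  involution.\<close>

lemma ext_deriv_grading:
  assumes "\<And>ws. (\<lambda>x. A x ws) differentiable at z"
  shows "ext_deriv (\<lambda>x ws. (- 1) ^ length ws * A x ws) z = (\<lambda>vs. - ((- 1) ^ length vs * ext_deriv A z vs))"
proof
  fix vs :: "'a list"
  \<comment> \<open>The form is evaluated on lists with one argument removed; the bound on
    \<open>i\<close> excludes the empty list, where the subtraction would truncate.\<close>
  have "(- 1 :: complex) ^ (length vs - Suc 0) = - ((- 1) ^ length vs)" if "i < length vs" for i
    using that by (cases vs) auto
  then show "ext_deriv (\<lambda>x ws. (- 1) ^ length ws * A x ws) z vs = - ((- 1) ^ length vs * ext_deriv A z vs)"
    using assms
    by (simp add: ext_deriv_def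
        frechet_derivative_bounded_linear[OF bounded_linear_minus[OF bounded_linear_mult_right]]
        sum_distrib_left mult_ac flip: sum_negf)
qed

lemma differentiable_wedge:
  assumes "\<And>ws. (\<lambda>x. A x ws) differentiable at z" and "\<And>ws. (\<lambda>x. B x ws) differentiable at z"
  shows "(\<lambda>x. (A x \<and>\<^sub>w B x) ws) differentiable at z"
  unfolding wedge_def by (intro differentiable_sum ballI differentiable_mult differentiable_const assms) auto

text \<open>The grading involution takes the place of the usual sign given by the degree of
  \<open>A\<close>, so the rule covers inhomogeneous forms. This is what the induction needs, as
  contraction and grading change the factors.\<close>

lemma ext_deriv_wedge:
  assumes "\<And>ws. (\<lambda>x. A x ws) differentiable at z" and "\<And>ws. (\<lambda>x. B x ws) differentiable at z"
  shows "ext_deriv (\<lambda>x. A x \<and>\<^sub>w B x) z =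
    (\<lambda>vs. (ext_deriv A z \<and>\<^sub>w B z) vs + ((\<lambda>ws. (- 1) ^ length ws * A z ws) \<and>\<^sub>w ext_deriv B z) vs)"
proof
  fix vs
  show "ext_deriv (\<lambda>x. A x \<and>\<^sub>w B x) z vs =
    (ext_deriv A z \<and>\<^sub>w B z) vs + ((\<lambda>ws. (- 1) ^ length ws * A z ws) \<and>\<^sub>w ext_deriv B z) vs"
    using assms
  proof (induction vs arbitrary: A B)
    case Nil
    then show ?case by (simp add: ext_deriv_Nil wedge_Nil)
  next
    case (Cons v vs)
    define sA where "sA x = (\<lambda>ws. (- 1) ^ length ws * A x ws)" for x
    define iA where "iA x = (\<lambda>ws. A x (v # ws))" for x
    define iB where "iB x = (\<lambda>ws. B x (v # ws))" for x
    note A = Cons.prems(1) and B = Cons.prems(2)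
    have sA: "(\<lambda>x. sA x ws) differentiable at z" for ws
      unfolding sA_def by (intro differentiable_mult differentiable_const A)
    have iA: "(\<lambda>x. iA x ws) differentiable at z" and iB: "(\<lambda>x. iB x ws) differentiable at z" for ws
      unfolding iA_def iB_def by (rule A B)+
    have "ext_deriv (\<lambda>x. A x \<and>\<^sub>w B x) z (v # vs) =
      frechet_derivative (\<lambda>x. (A x \<and>\<^sub>w B x) vs) (at z) v
      - ext_deriv (\<lambda>x ws. (iA x \<and>\<^sub>w B x) ws + (sA x \<and>\<^sub>w iB x) ws) z vs"
      by (simp only: ext_deriv_Cons wedge_Cons sA_def iA_def iB_def)
    also have "\<dots> = frechet_derivative (\<lambda>x. (A x \<and>\<^sub>w B x) vs) (at z) v
      - (ext_deriv (\<lambda>x. iA x \<and>\<^sub>w B x) z vs + ext_deriv (\<lambda>x. sA x \<and>\<^sub>w iB x) z vs)"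
      by (subst ext_deriv_add) (rule differentiable_wedge iA B sA iB refl)+
    \<comment> \<open>The product rule gives the derivatives along \<open>v\<close>, and the
      induction hypotheses treat the two contracted products. \<open>ext_deriv_grading\<close>
      supplies the sign that makes the terms regroup into the two sides of the Leibniz rule.\<close>
    finally show ?case
      unfolding frechet_derivative_wedge[OF A B] Cons.IH[OF iA B] Cons.IH[OF sA iB]
      unfolding wedge_Cons ext_deriv_Cons sA_def iA_def iB_def ext_deriv_grading[OF A]
      by (simp add: wedge_bilinear right_diff_distrib)
  qed
qed

section \<open>Operations on invariant smooth forms\<close>

lemma alternating_add: "alternating k A \<Longrightarrow> alternating k B \<Longrightarrow> alternating k (\<lambda>vs. A vs + B vs)"
  unfolding alternating_def by (simp add: linear_compose_add)

lemma alternating_mult: "alternating k A \<Longrightarrow> alternating k (\<lambda>vs. c * A vs)"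
  unfolding alternating_def by (simp add: linear_iff distrib_left)

lemma alternating_conj_cov: "alternating k A \<Longrightarrow> alternating k (conj_cov A)"
  unfolding alternating_def conj_cov_def by (simp add: linear_iff complex_cnj_scaleR)

lemma smooth_forms_differentiable: "A \<in> smooth_forms Y k \<Longrightarrow> (\<lambda>z. A z vs) differentiable at z"
  by (simp add: smooth_forms_def smooth_imp_differentiable)

lemma smooth_forms_wedge:
  "A \<in> smooth_forms Y p \<Longrightarrow> B \<in> smooth_forms Y q \<Longrightarrow> (\<lambda>z. A z \<and>\<^sub>w B z) \<in> smooth_forms Y (p + q)"
  by (auto simp: smooth_forms_def alternating_wedge smooth_wedge pullback_def wedge_map fun_eq_iff)

lemma smooth_forms_add:
  "A \<in> smooth_forms Y k \<Longrightarrow> B \<in> smooth_forms Y k \<Longrightarrow> (\<lambda>z vs. A z vs + B z vs) \<in> smooth_forms Y k"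
  by (auto simp: smooth_forms_def alternating_add smooth_add pullback_def fun_eq_iff)

lemma smooth_forms_mult: "A \<in> smooth_forms Y k \<Longrightarrow> (\<lambda>z vs. c * A z vs) \<in> smooth_forms Y k"
  by (auto simp: smooth_forms_def alternating_mult smooth_mult smooth_const pullback_def fun_eq_iff)

lemma smooth_forms_conj_cov: "A \<in> smooth_forms Y k \<Longrightarrow> (\<lambda>z. conj_cov (A z)) \<in> smooth_forms Y k"
  by (auto simp: smooth_forms_def alternating_conj_cov)
    (auto simp: smooth_cnj pullback_def conj_cov_def fun_eq_iff)

text \<open>On a 1-form the grading involution is multiplication by -1, since the form vanishes on
  lists of any other length.\<close>

lemma ext_deriv_one_form_wedge:
  assumes A: "A \<in> smooth_forms Y 1" and B: "B \<in> smooth_forms Y k"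
  shows "ext_deriv (\<lambda>z. A z \<and>\<^sub>w B z) z =
    (\<lambda>vs. (ext_deriv A z \<and>\<^sub>w B z) vs - (A z \<and>\<^sub>w ext_deriv B z) vs)"
proof -
  have "(\<lambda>ws. (- 1) ^ length ws * A z ws) = (\<lambda>ws. - A z ws)"
  proof
    fix ws show "(- 1) ^ length ws * A z ws = - A z ws"
      using A by (cases "length ws = 1") (auto simp: smooth_forms_def alternating_def)
  qed
  then show ?thesis
    by (simp add: ext_deriv_wedge[OF smooth_forms_differentiable[OF A] smooth_forms_differentiable[OF B]]
        wedge_minus_left)
qed

section \<open>Decomposition into types\<close>

lemma wedge_list_Nil: "wedge_list [] = one_cov"
  and wedge_list_Cons: "wedge_list (A # As) = A \<and>\<^sub>w wedge_list As"
  by (simp_all add: wedge_list_def wedge_one_cov)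

text \<open>The tail \<open>As\<close> with its own weight \<open>d\<close> allows two applications
  in a row: first to the conjugate factors with empty tail, then to the factors of type (1,0) in
  front of them.\<close>

lemma wedge_list_weight:
  assumes "\<And>\<phi> vs. \<phi> \<in> set \<phi>s \<Longrightarrow> \<phi> (map R vs) = c * \<phi> vs"
    and "\<And>vs. wedge_list As (map R vs) = d * wedge_list As vs"
  shows "wedge_list (\<phi>s @ As) (map R vs) = c ^ length \<phi>s * d * wedge_list (\<phi>s @ As) vs"
  using assms(1)
proof (induction \<phi>s arbitrary: vs)
  case Nil
  then show ?case by (simp add: assms(2))
next
  case (Cons \<phi> \<phi>s)
  have \<phi>: "\<phi> (map R ws) = c * \<phi> ws" for ws
    using Cons.prems by simp
  have IH: "wedge_list (\<phi>s @ As) (map R ws) = c ^ length \<phi>s * d * wedge_list (\<phi>s @ As) ws" for ws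
    using Cons.prems by (intro Cons.IH) simp
  show ?case
    unfolding append_Cons wedge_list_Cons wedge_map \<phi> IH wedge_bilinear
    by simp
qed

lemma pq_covectors_weight:
  assumes R: "\<And>\<phi> vs. \<phi> \<in> set P \<Longrightarrow> \<phi> (map R vs) = c * \<phi> vs" and A: "A \<in> pq_covectors P p q"
  shows "A (map R vs) = c ^ p * cnj c ^ q * A vs"
proof -
  have "wedge_list (\<phi>s @ map conj_cov \<psi>s) (map R vs)
      = c ^ p * cnj c ^ q * wedge_list (\<phi>s @ map conj_cov \<psi>s) vs"
    if "set \<phi>s \<subseteq> set P" "length \<phi>s = p" "set \<psi>s \<subseteq> set P" "length \<psi>s = q" for \<phi>s \<psi>s
  proof -
    have "wedge_list (map conj_cov \<psi>s @ []) (map R vs)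
        = cnj c ^ length (map conj_cov \<psi>s) * 1 * wedge_list (map conj_cov \<psi>s @ []) vs" for vs
      using that(3) by (intro wedge_list_weight) (auto simp: conj_cov_def R wedge_list_Nil one_cov_def)
    then show ?thesis
      using wedge_list_weight[of \<phi>s R c "map conj_cov \<psi>s" "cnj c ^ q" vs] that R[OF subsetD[OF that(1)]]
      by simp
  qed
  then show ?thesis
    using A unfolding pq_covectors_def by (auto simp: sum_distrib_left mult_ac intro!: sum.cong)
qed

text \<open>Surjectivity of the coframe map yields \<open>R\<close>, multiplication by
  \<open>c\<close> in the complex structure. The case \<open>c = \<i>\<close> is the almost complex
  structure, and unit scalars \<open>c\<close> serve to separate types.\<close>

lemma coframe_scaling:
  assumes "complex_structure Y"
  obtains R where "\<And>\<phi> vs. \<phi> \<in> set (coframe_at Y z) \<Longrightarrow> \<phi> (map R vs) = c * \<phi> vs"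
proof -
  have bij: "bij_betw (\<lambda>v. map (\<lambda>\<phi>. \<phi> [v]) (coframe_at Y z)) UNIV {ws. length ws = cdim Y}"
    using assms unfolding complex_structure_def by blast
  have "\<exists>w. \<forall>\<phi>\<in>set (coframe_at Y z). \<phi> [w] = c * \<phi> [v]" for v
  proof -
    have "map (\<lambda>\<phi>. c * \<phi> [v]) (coframe_at Y z) \<in> {ws. length ws = cdim Y}"
      by (simp add: coframe_at_def cdim_def)
    also have "\<dots> = (\<lambda>v. map (\<lambda>\<phi>. \<phi> [v]) (coframe_at Y z)) ` UNIV"
      using bij by (simp add: bij_betw_def)
    finally obtain w where "map (\<lambda>\<phi>. c * \<phi> [v]) (coframe_at Y z) = map (\<lambda>\<phi>. \<phi> [w]) (coframe_at Y z)"
      by blast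
    then show ?thesis by (intro exI[of _ w]) (auto simp: map_eq_conv)
  qed
  then obtain R where "\<forall>v. \<forall>\<phi>\<in>set (coframe_at Y z). \<phi> [R v] = c * \<phi> [v]"
    using choice[of "\<lambda>v w. \<forall>\<phi>\<in>set (coframe_at Y z). \<phi> [w] = c * \<phi> [v]"] by blast
  then have R: "\<phi> [R v] = c * \<phi> [v]" if "\<phi> \<in> set (coframe_at Y z)" for \<phi> v
    using that by blast
  have "\<phi> (map R vs) = c * \<phi> vs" if "\<phi> \<in> set (coframe_at Y z)" for \<phi> vs
  proof (cases "length vs = 1")
    case True
    then obtain v where "vs = [v]" by (auto simp: length_Suc_conv)
    then show ?thesis using R[OF that] by simp
  next
    case False
    moreover have "alternating 1 \<phi>"
      using that assms by (auto simp: coframe_at_def complex_structure_def smooth_forms_def)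
    ultimately show ?thesis by (simp add: alternating_def)
  qed
  then show thesis by (rule that)
qed

text \<open>
  For \<open>\<bar>c\<bar> = 1\<close>, the map scaling the coframe by \<open>c\<close> multiplies the component of type \<open>(r, k - r)\<close> by
  \<open>c\<^sup>2\<^sup>r\<^sup>-\<^sup>k\<close>, so the differences of the components are the coefficients of a polynomial in \<open>c\<^sup>2\<close> that vanishes
  on the unit circle.
\<close>

lemma pq_decomposition_unique:
  assumes Y: "complex_structure Y"
    and C: "\<And>r. r \<le> k \<Longrightarrow> C r \<in> pq_covectors (coframe_at Y z) r (k - r)"
    and C': "\<And>r. r \<le> k \<Longrightarrow> C' r \<in> pq_covectors (coframe_at Y z) r (k - r)"
    and eq: "(\<lambda>vs. \<Sum>r\<le>k. C r vs) = (\<lambda>vs. \<Sum>r\<le>k. C' r vs)"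
    and "p \<le> k"
  shows "C p = C' p"
proof
  fix vs
  define d where "d r = C r vs - C' r vs" for r
  have zero: "(\<Sum>r\<le>k. d r * x ^ r) = 0" if x: "cmod x = 1" for x
  proof -
    define c where "c = csqrt x"
    have c2: "c ^ 2 = x" by (simp add: c_def)
    then have "cmod c ^ 2 = 1" using x by (metis norm_power)
    then have c: "cmod c = 1" by (simp add: power2_eq_1_iff) (use norm_ge_zero[of c] in linarith)
    then have c1: "c * cnj c = 1" by (simp add: complex_norm_square[symmetric])
    obtain R where R: "\<And>\<phi> vs. \<phi> \<in> set (coframe_at Y z) \<Longrightarrow> \<phi> (map R vs) = c * \<phi> vs"
      by (rule coframe_scaling[OF Y, where z = z and c = c]) blast
    \<comment> \<open>As \<open>cnj c\<close> is the inverse of \<open>c\<close>, the factor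
      \<open>c ^ k\<close> turns the weight of type (r, k - r) into a nonnegative power of
      x.\<close>
    have "c ^ k * (c ^ r * cnj c ^ (k - r)) = x ^ r" if "r \<le> k" for r
    proof -
      have "c ^ k = c ^ r * c ^ (k - r)" using that by (simp flip: power_add)
      then have "c ^ k * (c ^ r * cnj c ^ (k - r)) = (c ^ 2) ^ r * (c * cnj c) ^ (k - r)"
        by (simp only: power_mult_distrib power2_eq_square mult_ac)
      then show ?thesis by (simp add: c1 c2)
    qed
    then have "(\<Sum>r\<le>k. d r * x ^ r) = (\<Sum>r\<le>k. d r * (c ^ k * (c ^ r * cnj c ^ (k - r))))"
      by (intro sum.cong refl) simp
    also have "\<dots> = (\<Sum>r\<le>k. c ^ k * (c ^ r * cnj c ^ (k - r) * C r vs)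
        - c ^ k * (c ^ r * cnj c ^ (k - r) * C' r vs))"
      by (intro sum.cong refl) (simp add: d_def algebra_simps)
    also have "\<dots> = c ^ k * ((\<Sum>r\<le>k. C r (map R vs)) - (\<Sum>r\<le>k. C' r (map R vs)))"
      unfolding sum_subtractf sum_distrib_left right_diff_distrib
      by (intro arg_cong2[where f = "(-)"] sum.cong refl)
        (simp_all add: pq_covectors_weight[OF R C] pq_covectors_weight[OF R C'])
    also have "\<dots> = 0" using fun_cong[OF eq, of "map R vs"] by simp
    finally show ?thesis .
  qed
  \<comment> \<open>A polynomial with infinitely many roots has only zero coefficients; the circle
    is infinite because it is connected and has two points.\<close>
  have "infinite (sphere (0::complex) 1)"
  proof -
    have "connected (sphere (0::complex) 1)" by (simp add: connected_sphere)
    moreover have "1 \<in> sphere (0::complex) 1" "- 1 \<in> sphere (0::complex) 1" "(1::complex) \<noteq> - 1"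
      by simp_all
    ultimately show ?thesis
      by (metis connected_finite_iff_sing empty_iff singletonD)
  qed
  moreover have "sphere 0 1 \<subseteq> {x. (\<Sum>r\<le>k. d r * x ^ r) = 0}"
    using zero by auto
  ultimately have "d p = 0"
    using polyfun_finite_roots[of d k] \<open>p \<le> k\<close> finite_subset by blast
  then show "C p vs = C' p vs" by (simp add: d_def)
qed

text \<open>Uniqueness makes the definite description in \<open>pq_part\<close> denote, so any one
  decomposition into types computes the component.\<close>

lemma pq_part_eq:
  assumes "complex_structure Y"
    and C: "\<And>r. r \<le> p + q \<Longrightarrow> C r \<in> pq_covectors (coframe_at Y z) r (p + q - r)"
    and \<omega>: "\<omega> z = (\<lambda>vs. \<Sum>r\<le>p + q. C r vs)"
  shows "pq_part Y p q \<omega> z = C p"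
  unfolding pq_part_def
proof (rule the_equality)
  show "\<exists>D. (\<forall>r\<le>p + q. D r \<in> pq_covectors (coframe_at Y z) r (p + q - r)) \<and>
      \<omega> z = (\<lambda>vs. \<Sum>r\<le>p + q. D r vs) \<and> C p = D p"
    by (intro exI[of _ C] conjI allI impI C \<omega> refl)
next
  fix A assume "\<exists>D. (\<forall>r\<le>p + q. D r \<in> pq_covectors (coframe_at Y z) r (p + q - r)) \<and>
      \<omega> z = (\<lambda>vs. \<Sum>r\<le>p + q. D r vs) \<and> A = D p"
  then obtain D where D: "\<And>r. r \<le> p + q \<Longrightarrow> D r \<in> pq_covectors (coframe_at Y z) r (p + q - r)"
    and eq: "\<omega> z = (\<lambda>vs. \<Sum>r\<le>p + q. D r vs)" and A: "A = D p"
    by blast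
  show "A = C p"
    unfolding A by (rule pq_decomposition_unique[OF assms(1) D C]) (simp_all flip: eq \<omega>)
qed

lemma pq_part_zero:
  assumes "complex_structure Y" and "\<omega> z = (\<lambda>vs. 0)"
  shows "pq_part Y p q \<omega> z = (\<lambda>vs. 0)"
  by (rule pq_part_eq[OF assms(1), where C = "\<lambda>_ _. 0"]) (simp_all add: pq_covectors_zero assms(2))

section \<open>Complex multiplication on tangent vectors\<close>

lemma cx_mult_coframe:
  assumes Y: "complex_structure Y" and \<phi>: "\<phi> \<in> set (coframe_at Y z)"
  shows "\<phi> [cx_mult Y z v] = \<i> * \<phi> [v]"
proof -
  obtain R where R: "\<And>\<phi> vs. \<phi> \<in> set (coframe_at Y z) \<Longrightarrow> \<phi> (map R vs) = \<i> * \<phi> vs"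
    by (rule coframe_scaling[OF Y, where z = z and c = \<i>]) blast
  have inj: "inj (\<lambda>v. map (\<lambda>\<phi>. \<phi> [v]) (coframe_at Y z))"
    using Y unfolding complex_structure_def bij_betw_def by blast
  have "\<exists>!w. \<forall>\<phi>\<in>set (coframe_at Y z). \<phi> [w] = \<i> * \<phi> [v]"
  proof (rule ex1I[of _ "R v"])
    show "\<forall>\<phi>\<in>set (coframe_at Y z). \<phi> [R v] = \<i> * \<phi> [v]"
      using R[of _ "[v]"] by simp
    then show "w = R v" if "\<forall>\<phi>\<in>set (coframe_at Y z). \<phi> [w] = \<i> * \<phi> [v]" for w
      using that by (intro injD[OF inj]) (auto simp: map_eq_conv)
  qed
  from theI'[OF this] show ?thesis
    using \<phi> unfolding cx_mult_def by blast
qed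

lemma coframe_separates:
  assumes "complex_structure Y" and "\<And>\<phi>. \<phi> \<in> set (coframe_at Y z) \<Longrightarrow> \<phi> [v] = \<phi> [w]"
  shows "v = w"
proof -
  have inj: "inj (\<lambda>v. map (\<lambda>\<phi>. \<phi> [v]) (coframe_at Y z))"
    using assms(1) unfolding complex_structure_def bij_betw_def by blast
  show ?thesis
    using assms(2) by (intro injD[OF inj]) (auto simp: map_eq_conv)
qed

lemma conj_cov_covector: "conj_cov (covector f) = covector (\<lambda>v. cnj (f v))"
  by (auto simp: conj_cov_def covector_def split: list.split)

section \<open>The structure equation of the coframe\<close>

text \<open>
  With \<open>T\<close> the matrix of the \<open>t\<^sub>i\<^sub>\<lambda>\<close> for \<open>i \<le> 2\<close>, the expression is \<open>det (1 - T T')\<close>, where \<open>T'\<close> is the complex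
  conjugate. If \<open>w = T T' w\<close> with \<open>w \<noteq> 0\<close>, then \<open>u = w - T w'\<close> satisfies \<open>u + T u' = 0\<close>, and so does
  \<open>\<i> w\<close> in case \<open>u = 0\<close>; a nonzero solution is a tangent vector killed by the coframe.
\<close>

lemma param_det_nonzero_of_complex_structure:
  assumes Y: "complex_structure (iwasawa_deform t)" and t: "t$3$1 = 0" "t$3$2 = 0"
  shows "(1 - t$1$1 * cnj (t$1$1) - t$1$2 * cnj (t$2$1)) * (1 - t$2$1 * cnj (t$1$2) - t$2$2 * cnj (t$2$2))
    - (t$1$1 * cnj (t$1$2) + t$1$2 * cnj (t$2$2)) * (t$2$1 * cnj (t$1$1) + t$2$2 * cnj (t$2$1)) \<noteq> 0"
    (is "?n \<noteq> 0")
proof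
  assume n: "?n = 0"
  have separates: "x = 0 \<and> y = 0"
    if "x + t$1$1 * cnj x + t$1$2 * cnj y = 0" "y + t$2$1 * cnj x + t$2$2 * cnj y = 0" for x y
  proof -
    \<comment> \<open>At the origin and with the two coordinates of \<open>t\<close> zero,
      \<open>\<gamma>\<^sub>t\<close> kills every vector with third entry 0; the two equations say
      that the other two forms kill this one.\<close>
    have "(vector [x, y, 0] :: complex^3) = 0"
    proof (rule coframe_separates[OF Y])
      fix \<phi> assume "\<phi> \<in> set (coframe_at (iwasawa_deform t) 0)"
      then show "\<phi> [vector [x, y, 0]] = \<phi> [0]"
        using that t
        by (auto simp: coframe_at_def iwasawa_deform_def alpha_t_eq beta_t_eq gamma_t_eq
            covector_single gamma_fun_def)
    qed
    then show ?thesis by (simp add: vec_eq_iff forall_3)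
  qed
  define m11 where "m11 = t$1$1 * cnj (t$1$1) + t$1$2 * cnj (t$2$1)"
  define m12 where "m12 = t$1$1 * cnj (t$1$2) + t$1$2 * cnj (t$2$2)"
  define m21 where "m21 = t$2$1 * cnj (t$1$1) + t$2$2 * cnj (t$2$1)"
  define m22 where "m22 = t$2$1 * cnj (t$1$2) + t$2$2 * cnj (t$2$2)"
  have det: "(1 - m11) * (1 - m22) = m12 * m21"
    using n by (simp add: m11_def m12_def m21_def m22_def algebra_simps)
  \<comment> \<open>A kernel vector of the singular matrix 1 - M is read off from its second row, or
    from its first row if the second is zero; if both are zero, any vector will do.\<close>
  obtain x y where xy: "x \<noteq> 0 \<or> y \<noteq> 0" "x = m11 * x + m12 * y" "y = m21 * x + m22 * y"
  proof (cases "m22 = 1 \<and> m21 = 0")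
    case False
    then show thesis
      by (intro that[of "1 - m22" m21]) (use det in \<open>auto simp: algebra_simps\<close>)
  next
    case m2: True
    show thesis
    proof (cases "m12 = 0 \<and> m11 = 1")
      case False
      then show thesis
        by (intro that[of m12 "1 - m11"]) (use m2 in \<open>auto simp: algebra_simps\<close>)
    next
      case True
      then show thesis
        by (intro that[of 1 0]) (use m2 in auto)
    qed
  qed
  have "x - (t$1$1 * cnj x + t$1$2 * cnj y) = 0 \<and> y - (t$2$1 * cnj x + t$2$2 * cnj y) = 0"
  proof (rule separates)
    show "x - (t$1$1 * cnj x + t$1$2 * cnj y) + t$1$1 * cnj (x - (t$1$1 * cnj x + t$1$2 * cnj y))
        + t$1$2 * cnj (y - (t$2$1 * cnj x + t$2$2 * cnj y)) = 0"
      using xy(2) by (simp add: m11_def m12_def algebra_simps)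
    show "y - (t$2$1 * cnj x + t$2$2 * cnj y) + t$2$1 * cnj (x - (t$1$1 * cnj x + t$1$2 * cnj y))
        + t$2$2 * cnj (y - (t$2$1 * cnj x + t$2$2 * cnj y)) = 0"
      using xy(3) by (simp add: m21_def m22_def algebra_simps)
  qed
  then have "x = t$1$1 * cnj x + t$1$2 * cnj y" "y = t$2$1 * cnj x + t$2$2 * cnj y"
    by simp_all
  then have "\<i> * x + t$1$1 * cnj (\<i> * x) + t$1$2 * cnj (\<i> * y) = 0"
    "\<i> * y + t$2$1 * cnj (\<i> * x) + t$2$2 * cnj (\<i> * y) = 0"
    by (simp_all, algebra+)
  from separates[OF this] xy(1) show False by simp
qed

text \<open>Since the base may be a ball of any admissible radius, the determinant is nonzero by the
  complex structure and not by a bound on \<open>t\<close>. The coefficients are independent of the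
  point, so later derivatives fall on the monomials only.\<close>

lemma ext_deriv_gamma_t_coframe:
  assumes Y: "complex_structure (iwasawa_deform t)" and t: "t$3$1 = 0" "t$3$2 = 0"
  obtains k1 k2 k3 k4 k5 where
    "\<And>z. ext_deriv (\<gamma>\<^sub>t t) z = (\<lambda>vs. k1 * (\<alpha>\<^sub>t t z \<and>\<^sub>w \<beta>\<^sub>t t z) vs
        + k2 * (\<alpha>\<^sub>t t z \<and>\<^sub>w conj_cov (\<alpha>\<^sub>t t z)) vs + k3 * (\<alpha>\<^sub>t t z \<and>\<^sub>w conj_cov (\<beta>\<^sub>t t z)) vs
        + k4 * (\<beta>\<^sub>t t z \<and>\<^sub>w conj_cov (\<alpha>\<^sub>t t z)) vs + k5 * (\<beta>\<^sub>t t z \<and>\<^sub>w conj_cov (\<beta>\<^sub>t t z)) vs)"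
proof -
  define a where "a = (\<lambda>v::complex^3. v$1 + t$1$1 * cnj (v$1) + t$1$2 * cnj (v$2))"
  define b where "b = (\<lambda>v::complex^3. v$2 + t$2$1 * cnj (v$1) + t$2$2 * cnj (v$2))"
  define n where "n = (1 - t$1$1 * cnj (t$1$1) - t$1$2 * cnj (t$2$1)) * (1 - t$2$1 * cnj (t$1$2) - t$2$2 * cnj (t$2$2))
    - (t$1$1 * cnj (t$1$2) + t$1$2 * cnj (t$2$2)) * (t$2$1 * cnj (t$1$1) + t$2$2 * cnj (t$2$1))"
  have n0: "n \<noteq> 0"
    unfolding n_def by (rule param_det_nonzero_of_complex_structure[OF assms])
  define D where "D = kuranishi_D t"
  \<comment> \<open>The left side is d\<gamma> of the deformed coframe, namely -\<alpha>\<beta> plus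
    D times its conjugate product; \<open>torsion_identity\<close> divided by \<open>n\<close>
    rewrites it in the deformed coframe.\<close>
  have e: "- (v$1 * w$2 - w$1 * v$2) + D * cnj (v$1 * w$2 - w$1 * v$2) =
      (D * cnj D - 1) / n * (a v * b w - a w * b v)
      + (t$2$1 + D * cnj (t$2$1)) / n * (a v * cnj (a w) - a w * cnj (a v))
      + (t$2$2 - D * cnj (t$1$1)) / n * (a v * cnj (b w) - a w * cnj (b v))
      + (D * cnj (t$2$2) - t$1$1) / n * (b v * cnj (a w) - b w * cnj (a v))
      + - (t$1$2 + D * cnj (t$1$2)) / n * (b v * cnj (b w) - b w * cnj (b v))"
      (is "?l = ?r") for v w
  proof -
    have "n * (- (v$1 * w$2 - w$1 * v$2) + D * cnj (v$1 * w$2 - w$1 * v$2)) =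
        (D * cnj D - 1) * (a v * b w - a w * b v)
        + (t$2$1 + D * cnj (t$2$1)) * (a v * cnj (a w) - a w * cnj (a v))
        + (t$2$2 - D * cnj (t$1$1)) * (a v * cnj (b w) - a w * cnj (b v))
        + (D * cnj (t$2$2) - t$1$1) * (b v * cnj (a w) - b w * cnj (a v))
        - (t$1$2 + D * cnj (t$1$2)) * (b v * cnj (b w) - b w * cnj (b v))"
      unfolding n_def D_def kuranishi_D_def complex_cnj_diff complex_cnj_mult
      by (rule torsion_identity[of "a v" "v$1" "t$1$1" "cnj (v$1)" "t$1$2" "cnj (v$2)" "b v" "v$2" "t$2$1" "t$2$2"
            "cnj (a v)" "cnj (t$1$1)" "cnj (t$1$2)" "cnj (b v)" "cnj (t$2$1)" "cnj (t$2$2)"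
            "a w" "w$1" "cnj (w$1)" "cnj (w$2)" "b w" "w$2" "cnj (a w)" "cnj (b w)"])
         (simp_all add: a_def b_def)
    also have "\<dots> = n * ?r"
      using n0 by (simp add: distrib_left) algebra
    finally show ?thesis using n0 by simp
  qed
  have coframe: "\<alpha>\<^sub>t t z = covector a" "\<beta>\<^sub>t t z = covector b" for z
    by (simp_all add: alpha_t_eq beta_t_eq a_def b_def)
  show thesis
    by (rule that[of "(D * cnj D - 1) / n" "(t$2$1 + D * cnj (t$2$1)) / n" "(t$2$2 - D * cnj (t$1$1)) / n"
          "(D * cnj (t$2$2) - t$1$1) / n" "- (t$1$2 + D * cnj (t$1$2)) / n"])
      (unfold ext_deriv_gamma_t coframe conj_cov_covector covector_wedge_covector D_def[symmetric] e,
        simp add: bicovector_def fun_eq_iff split: list.split)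
qed

section \<open>Monomials in six covectors\<close>

context
  fixes fa fb fc fa' fb' fc' :: "'a \<Rightarrow> complex"
begin

private abbreviation (input) "a \<equiv> covector fa"
private abbreviation (input) "b \<equiv> covector fb"
private abbreviation (input) "c \<equiv> covector fc"
private abbreviation (input) "a' \<equiv> covector fa'"
private abbreviation (input) "b' \<equiv> covector fb'"
private abbreviation (input) "c' \<equiv> covector fc'"

text \<open>Each instance moves one pair towards the order a, b, c, a', b', c', so rewriting ends in
  sorted monomials or in zero. Conjugates enter as unrelated covectors.\<close>

private lemmas wedge_sort =
  wedge_left_same wedge_same
  wedge_left_commute[of fb fa] wedge_left_commute[of fc fa] wedge_left_commute[of fa' fa]
  wedge_left_commute[of fb' fa] wedge_left_commute[of fc' fa] wedge_left_commute[of fc fb]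
  wedge_left_commute[of fa' fb] wedge_left_commute[of fb' fb] wedge_left_commute[of fc' fb]
  wedge_left_commute[of fa' fc] wedge_left_commute[of fb' fc] wedge_left_commute[of fc' fc]
  wedge_left_commute[of fb' fa'] wedge_left_commute[of fc' fa'] wedge_left_commute[of fc' fb']
  wedge_commute[of fb fa] wedge_commute[of fc fa] wedge_commute[of fa' fa]
  wedge_commute[of fb' fa] wedge_commute[of fc' fa] wedge_commute[of fc fb]
  wedge_commute[of fa' fb] wedge_commute[of fb' fb] wedge_commute[of fc' fb]
  wedge_commute[of fa' fc] wedge_commute[of fb' fc] wedge_commute[of fc' fc]
  wedge_commute[of fb' fa'] wedge_commute[of fc' fa'] wedge_commute[of fc' fb']

text \<open>Squares of summands vanish and each mixed product occurs twice; the factor \<i> squared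
  cancels the sign of sorting a a' b b' into a b a' b'.\<close>

lemma diagonal_metric_square:
  assumes "\<omega> = (\<lambda>vs. \<i> * (a \<and>\<^sub>w a') vs + \<i> * (b \<and>\<^sub>w b') vs + \<i> * (c \<and>\<^sub>w c') vs)"
  shows "\<omega> \<and>\<^sub>w \<omega> = (\<lambda>vs. 2 * ((a \<and>\<^sub>w b \<and>\<^sub>w a' \<and>\<^sub>w b') vs + ((a \<and>\<^sub>w c \<and>\<^sub>w a' \<and>\<^sub>w c') vs + (b \<and>\<^sub>w c \<and>\<^sub>w b' \<and>\<^sub>w c') vs)))"
  unfolding assms by (simp add: wedge_bilinear wedge_assoc wedge_sort fun_eq_iff algebra_simps)

text \<open>The left side is the Leibniz expansion of d(a c a' c' + b c b' c') for closed a, b, a',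
  b'. Next to a and a' only the b b' term of \<open>dc\<close> survives, and next to b and b' only
  the a a' term; likewise for \<open>dc'\<close>.\<close>

lemma torsion_wedge_square:
  assumes "dc = (\<lambda>vs. k1 * (a \<and>\<^sub>w b) vs + k2 * (a \<and>\<^sub>w a') vs + k3 * (a \<and>\<^sub>w b') vs
      + k4 * (b \<and>\<^sub>w a') vs + k5 * (b \<and>\<^sub>w b') vs)"
    and "dc' = (\<lambda>vs. l1 * (a' \<and>\<^sub>w b') vs + l2 * (a' \<and>\<^sub>w a) vs + l3 * (a' \<and>\<^sub>w b) vs
      + l4 * (b' \<and>\<^sub>w a) vs + l5 * (b' \<and>\<^sub>w b) vs)"
  shows "- (a \<and>\<^sub>w (\<lambda>vs. (dc \<and>\<^sub>w a' \<and>\<^sub>w c') vs - (c \<and>\<^sub>w (\<lambda>vs. - (a' \<and>\<^sub>w dc') vs)) vs)) vs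
      + - (b \<and>\<^sub>w (\<lambda>vs. (dc \<and>\<^sub>w b' \<and>\<^sub>w c') vs - (c \<and>\<^sub>w (\<lambda>vs. - (b' \<and>\<^sub>w dc') vs)) vs)) vs =
      (k2 + k5) * (a \<and>\<^sub>w b \<and>\<^sub>w a' \<and>\<^sub>w b' \<and>\<^sub>w c') vs + (l2 + l5) * (a \<and>\<^sub>w b \<and>\<^sub>w c \<and>\<^sub>w a' \<and>\<^sub>w b') vs"
  unfolding assms by (simp add: wedge_bilinear wedge_assoc wedge_sort algebra_simps)

lemma torsion_wedge_top:
  assumes "dc' = (\<lambda>vs. l1 * (a' \<and>\<^sub>w b') vs + l2 * (a' \<and>\<^sub>w a) vs + l3 * (a' \<and>\<^sub>w b) vs
      + l4 * (b' \<and>\<^sub>w a) vs + l5 * (b' \<and>\<^sub>w b) vs)"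
  shows "a \<and>\<^sub>w b \<and>\<^sub>w a' \<and>\<^sub>w b' \<and>\<^sub>w dc' = (\<lambda>vs. 0)"
  unfolding assms by (simp add: wedge_bilinear wedge_assoc wedge_sort)

end


section \<open>The metric on the deformed manifolds\<close>

lemma coframe_t_smooth_forms:
  shows "\<alpha>\<^sub>t t \<in> smooth_forms (iwasawa_deform t) 1"
    and "\<beta>\<^sub>t t \<in> smooth_forms (iwasawa_deform t) 1"
    and "\<gamma>\<^sub>t t \<in> smooth_forms (iwasawa_deform t) 1"
  using coframe_smooth_forms by auto

lemma set_coframe_at_deform: "set (coframe_at (iwasawa_deform t) z) = {\<alpha>\<^sub>t t z, \<beta>\<^sub>t t z, \<gamma>\<^sub>t t z}"
  by (simp add: coframe_at_def iwasawa_deform_def)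

lemma omega_t_smooth_forms: "\<omega>\<^sub>t t \<in> smooth_forms (iwasawa_deform t) 2"
proof -
  have "(\<lambda>z vs. \<i> * (\<alpha>\<^sub>t t z \<and>\<^sub>w conj_cov (\<alpha>\<^sub>t t z)) vs + \<i> * (\<beta>\<^sub>t t z \<and>\<^sub>w conj_cov (\<beta>\<^sub>t t z)) vs
      + \<i> * (\<gamma>\<^sub>t t z \<and>\<^sub>w conj_cov (\<gamma>\<^sub>t t z)) vs) \<in> smooth_forms (iwasawa_deform t) (1 + 1)"
    by (intro smooth_forms_add smooth_forms_mult smooth_forms_wedge smooth_forms_conj_cov
        coframe_t_smooth_forms)
  then show ?thesis by (simp add: \<omega>\<^sub>t_def[abs_def] numeral_2_eq_2)
qed

text \<open>Conjugation exchanges the factors of each summand, which costs a sign, and the conjugate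
  of \<i> restores it.\<close>

lemma conj_cov_omega_t: "conj_cov (\<omega>\<^sub>t t z) = \<omega>\<^sub>t t z"
proof -
  have "conj_cov (covector f \<and>\<^sub>w conj_cov (covector f)) = (\<lambda>vs. - (covector f \<and>\<^sub>w conj_cov (covector f)) vs)"
    for f :: "complex^3 \<Rightarrow> complex"
    unfolding conj_cov_wedge conj_cov_covector by (subst wedge_commute) simp
  from fun_cong[OF this] have "cnj ((covector f \<and>\<^sub>w conj_cov (covector f)) vs) = - (covector f \<and>\<^sub>w conj_cov (covector f)) vs"
    for f :: "complex^3 \<Rightarrow> complex" and vs
    by (simp add: conj_cov_def)
  then show ?thesis
    by (simp add: fun_eq_iff conj_cov_def[of "\<omega>\<^sub>t t z"] \<omega>\<^sub>t_def alpha_t_eq beta_t_eq gamma_t_eq)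
qed

lemma real_form_iff_conj_cov: "real_form \<omega> \<longleftrightarrow> (\<forall>z. conj_cov (\<omega> z) = \<omega> z)"
  by (simp add: real_form_def fun_eq_iff conj_cov_def Reals_cnj_iff)

lemma hermitian_metric_omega_t:
  assumes Y: "complex_structure (iwasawa_deform t)"
  shows "hermitian_metric (iwasawa_deform t) (\<omega>\<^sub>t t)"
  unfolding hermitian_metric_def
proof (intro conjI allI impI)
  let ?P = "coframe_at (iwasawa_deform t)"
  have pq: "(\<lambda>vs. \<i> * (\<phi> \<and>\<^sub>w conj_cov \<phi>) vs) \<in> pq_covectors (?P z) 1 1" if "\<phi> \<in> set (?P z)" for \<phi> z
    using pq_covectors_single[of "[\<phi>]" "?P z" 1 "[\<phi>]" 1 \<i>] that
    by (simp add: wedge_list_Cons wedge_list_Nil wedge_one_cov)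
  have "\<omega>\<^sub>t t z \<in> pq_covectors (?P z) 1 1" for z
    unfolding \<omega>\<^sub>t_def[abs_def]
    by (intro pq_covectors_add pq) (simp_all add: set_coframe_at_deform)
  then show "\<omega>\<^sub>t t \<in> pq_forms (iwasawa_deform t) 1 1"
    using omega_t_smooth_forms by (simp add: pq_forms_def numeral_2_eq_2)
  show "real_form (\<omega>\<^sub>t t)"
    by (simp add: real_form_iff_conj_cov conj_cov_omega_t)
  fix z v :: "complex^3" assume "v \<noteq> 0"
  \<comment> \<open>With \<phi>(Jv) = \<i> \<phi>(v) the wedge evaluates to -2 \<i> times the
    squared modulus of \<phi>(v).\<close>
  have summand: "\<i> * (\<phi> \<and>\<^sub>w conj_cov \<phi>) [v, cx_mult (iwasawa_deform t) z v] = of_real (2 * (cmod (\<phi> [v]))\<^sup>2)"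
    if \<phi>: "\<phi> \<in> set (?P z)" for \<phi>
  proof -
    obtain f where f: "\<phi> = covector f"
      using \<phi> unfolding set_coframe_at_deform alpha_t_eq beta_t_eq gamma_t_eq by blast
    have "f (cx_mult (iwasawa_deform t) z v) = \<i> * f v"
      using cx_mult_coframe[OF Y \<phi>] by (simp add: f covector_single)
    then show ?thesis
      by (simp add: f conj_cov_covector covector_wedge_covector bicovector_def covector_single
          complex_norm_square del: of_real_power)
  qed
  have "\<omega>\<^sub>t t z [v, cx_mult (iwasawa_deform t) z v] =
      of_real (2 * (cmod (\<alpha>\<^sub>t t z [v]))\<^sup>2 + 2 * (cmod (\<beta>\<^sub>t t z [v]))\<^sup>2 + 2 * (cmod (\<gamma>\<^sub>t t z [v]))\<^sup>2)"
    unfolding \<omega>\<^sub>t_def of_real_add by (simp only: summand set_coframe_at_deform insert_iff simp_thms)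
  moreover have "\<alpha>\<^sub>t t z [v] \<noteq> 0 \<or> \<beta>\<^sub>t t z [v] \<noteq> 0 \<or> \<gamma>\<^sub>t t z [v] \<noteq> 0"
  proof (rule ccontr)
    assume "\<not> ?thesis"
    then have "\<phi> [v] = \<phi> [0]" if "\<phi> \<in> set (?P z)" for \<phi>
      using that cx_mult_coframe[OF Y, of _ z 0]
      by (auto simp: set_coframe_at_deform alpha_t_eq beta_t_eq gamma_t_eq covector_single gamma_fun_def)
    then have "v = 0"
      by (rule coframe_separates[OF Y])
    with \<open>v \<noteq> 0\<close> show False ..
  qed
  then have "0 < 2 * (cmod (\<alpha>\<^sub>t t z [v]))\<^sup>2 + 2 * (cmod (\<beta>\<^sub>t t z [v]))\<^sup>2 + 2 * (cmod (\<gamma>\<^sub>t t z [v]))\<^sup>2"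
    by (smt (verit) zero_le_power2 zero_less_power2 norm_eq_zero)
  ultimately show "0 < Re (\<omega>\<^sub>t t z [v, cx_mult (iwasawa_deform t) z v])"
    by simp
qed

section \<open>The square of the metric and its derivatives\<close>

lemma omega_t_square:
  "form_power (\<omega>\<^sub>t t) 2 = (\<lambda>z vs. 2 *
     ((\<alpha>\<^sub>t t z \<and>\<^sub>w \<beta>\<^sub>t t z \<and>\<^sub>w conj_cov (\<alpha>\<^sub>t t z) \<and>\<^sub>w conj_cov (\<beta>\<^sub>t t z)) vs
      + ((\<alpha>\<^sub>t t z \<and>\<^sub>w \<gamma>\<^sub>t t z \<and>\<^sub>w conj_cov (\<alpha>\<^sub>t t z) \<and>\<^sub>w conj_cov (\<gamma>\<^sub>t t z)) vs
       + (\<beta>\<^sub>t t z \<and>\<^sub>w \<gamma>\<^sub>t t z \<and>\<^sub>w conj_cov (\<beta>\<^sub>t t z) \<and>\<^sub>w conj_cov (\<gamma>\<^sub>t t z)) vs)))"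
proof
  fix z
  have "form_power (\<omega>\<^sub>t t) 2 z = \<omega>\<^sub>t t z \<and>\<^sub>w \<omega>\<^sub>t t z"
    by (simp add: form_power_def numeral_2_eq_2 wedge_list_Cons wedge_list_Nil wedge_one_cov)
  then show "form_power (\<omega>\<^sub>t t) 2 z = (\<lambda>vs. 2 *
     ((\<alpha>\<^sub>t t z \<and>\<^sub>w \<beta>\<^sub>t t z \<and>\<^sub>w conj_cov (\<alpha>\<^sub>t t z) \<and>\<^sub>w conj_cov (\<beta>\<^sub>t t z)) vs
      + ((\<alpha>\<^sub>t t z \<and>\<^sub>w \<gamma>\<^sub>t t z \<and>\<^sub>w conj_cov (\<alpha>\<^sub>t t z) \<and>\<^sub>w conj_cov (\<gamma>\<^sub>t t z)) vs
       + (\<beta>\<^sub>t t z \<and>\<^sub>w \<gamma>\<^sub>t t z \<and>\<^sub>w conj_cov (\<beta>\<^sub>t t z) \<and>\<^sub>w conj_cov (\<gamma>\<^sub>t t z)) vs)))"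
    using diagonal_metric_square[of "\<omega>\<^sub>t t z"]
    by (simp add: \<omega>\<^sub>t_def[abs_def] alpha_t_eq beta_t_eq gamma_t_eq conj_cov_covector)
qed


lemma omega_t_square_smooth_forms: "form_power (\<omega>\<^sub>t t) 2 \<in> smooth_forms (iwasawa_deform t) 4"
proof -
  have "(\<lambda>z. \<omega>\<^sub>t t z \<and>\<^sub>w \<omega>\<^sub>t t z) \<in> smooth_forms (iwasawa_deform t) (2 + 2)"
    by (intro smooth_forms_wedge omega_t_smooth_forms)
  then show ?thesis
    by (simp add: form_power_def[abs_def] numeral_eq_Suc wedge_list_Cons wedge_list_Nil wedge_one_cov)
qed

lemma omega_t_square_pq_forms: "form_power (\<omega>\<^sub>t t) 2 \<in> pq_forms (iwasawa_deform t) 2 2"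
proof -
  let ?P = "coframe_at (iwasawa_deform t)"
  have pq: "(\<lambda>vs. 2 * (\<phi> \<and>\<^sub>w \<psi> \<and>\<^sub>w conj_cov \<phi> \<and>\<^sub>w conj_cov \<psi>) vs) \<in> pq_covectors (?P z) 2 2"
    if "\<phi> \<in> set (?P z)" "\<psi> \<in> set (?P z)" for \<phi> \<psi> z
    using pq_covectors_single[of "[\<phi>, \<psi>]" "?P z" 2 "[\<phi>, \<psi>]" 2 2] that
    by (simp add: wedge_list_Cons wedge_list_Nil wedge_one_cov)
  have "form_power (\<omega>\<^sub>t t) 2 z \<in> pq_covectors (?P z) 2 2" for z
    unfolding omega_t_square distrib_left
    by (intro pq_covectors_add pq) (simp_all add: set_coframe_at_deform)
  then show ?thesis
    using omega_t_square_smooth_forms by (simp add: pq_forms_def)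
qed

lemma real_form_omega_t_square: "real_form (form_power (\<omega>\<^sub>t t) 2)"
  by (simp add: real_form_iff_conj_cov form_power_def numeral_2_eq_2 wedge_list_Cons wedge_list_Nil
      wedge_one_cov conj_cov_wedge conj_cov_omega_t)

lemma ext_deriv_alpha_t: "ext_deriv (\<alpha>\<^sub>t t) z = (\<lambda>vs. 0)"
  and ext_deriv_beta_t: "ext_deriv (\<beta>\<^sub>t t) z = (\<lambda>vs. 0)"
  by (rule ext_deriv_const[OF alpha_t_eq], rule ext_deriv_const[OF beta_t_eq])

lemma ext_deriv_conj_coframe_t:
  "ext_deriv (\<lambda>z. conj_cov (\<alpha>\<^sub>t t z)) z = (\<lambda>vs. 0)"
  "ext_deriv (\<lambda>z. conj_cov (\<beta>\<^sub>t t z)) z = (\<lambda>vs. 0)"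
  "ext_deriv (\<lambda>z. conj_cov (\<gamma>\<^sub>t t z)) z = conj_cov (ext_deriv (\<gamma>\<^sub>t t) z)"
  by (simp_all add: ext_deriv_conj_cov coframe_t_smooth_forms[THEN smooth_forms_differentiable]
      ext_deriv_alpha_t ext_deriv_beta_t)
    (simp_all add: conj_cov_def fun_eq_iff)

lemma ext_deriv_closed_wedge:
  assumes "A \<in> smooth_forms Y 1" "B \<in> smooth_forms Y k" "ext_deriv A z = (\<lambda>vs. 0)"
  shows "ext_deriv (\<lambda>z. A z \<and>\<^sub>w B z) z = (\<lambda>vs. - (A z \<and>\<^sub>w ext_deriv B z) vs)"
  by (simp add: ext_deriv_one_form_wedge[OF assms(1,2)] assms(3) wedge_zero_left)

lemma deldelbar_omega_t_square:
  assumes Y: "complex_structure (iwasawa_deform t)" and t: "t$3$1 = 0" "t$3$2 = 0"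
  shows "deldelbar (iwasawa_deform t) 2 2 (form_power (\<omega>\<^sub>t t) 2) = (\<lambda>z vs. 0)"
proof -
  let ?Y = "iwasawa_deform t"
  define a where "a = \<alpha>\<^sub>t t"
  define b where "b = \<beta>\<^sub>t t"
  define c where "c = \<gamma>\<^sub>t t"
  define a' where "a' z = conj_cov (a z)" for z
  define b' where "b' z = conj_cov (b z)" for z
  define c' where "c' z = conj_cov (c z)" for z
  have S: "a \<in> smooth_forms ?Y 1" "b \<in> smooth_forms ?Y 1" "c \<in> smooth_forms ?Y 1"
    "a' \<in> smooth_forms ?Y 1" "b' \<in> smooth_forms ?Y 1" "c' \<in> smooth_forms ?Y 1"
    using coframe_t_smooth_forms[of t]
    by (auto simp: a_def b_def c_def a'_def[abs_def] b'_def[abs_def] c'_def[abs_def] intro!: smooth_forms_conj_cov)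
  note SW = smooth_forms_wedge[OF S(1)] smooth_forms_wedge[OF S(2)] smooth_forms_wedge[OF S(3)]
    smooth_forms_wedge[OF S(4)] smooth_forms_wedge[OF S(5)] S
  have closed: "ext_deriv a z = (\<lambda>vs. 0)" "ext_deriv b z = (\<lambda>vs. 0)"
    "ext_deriv a' z = (\<lambda>vs. 0)" "ext_deriv b' z = (\<lambda>vs. 0)" for z
    by (simp_all add: a_def b_def a'_def[abs_def] b'_def[abs_def]
        ext_deriv_alpha_t ext_deriv_beta_t ext_deriv_conj_coframe_t)
  note d_closed = ext_deriv_closed_wedge[OF S(1) _ closed(1)] ext_deriv_closed_wedge[OF S(2) _ closed(2)]
    ext_deriv_closed_wedge[OF S(4) _ closed(3)] ext_deriv_closed_wedge[OF S(5) _ closed(4)]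
  obtain k1 k2 k3 k4 k5 where dc: "ext_deriv c z = (\<lambda>vs. k1 * (a z \<and>\<^sub>w b z) vs + k2 * (a z \<and>\<^sub>w a' z) vs
      + k3 * (a z \<and>\<^sub>w b' z) vs + k4 * (b z \<and>\<^sub>w a' z) vs + k5 * (b z \<and>\<^sub>w b' z) vs)" for z
    by (rule ext_deriv_gamma_t_coframe[OF assms, folded a_def b_def c_def, folded a'_def b'_def]) blast
  \<comment> \<open>Conjugating the structure equation keeps the order of the factors, which gives
    the unsorted monomials expected by \<open>torsion_wedge_square\<close>.\<close>
  have dc': "ext_deriv c' z = (\<lambda>vs. cnj k1 * (a' z \<and>\<^sub>w b' z) vs + cnj k2 * (a' z \<and>\<^sub>w a z) vs
      + cnj k3 * (a' z \<and>\<^sub>w b z) vs + cnj k4 * (b' z \<and>\<^sub>w a z) vs + cnj k5 * (b' z \<and>\<^sub>w b z) vs)" for z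
  proof -
    have conj: "conj_cov (a' z) = a z" "conj_cov (b' z) = b z"
      by (simp_all add: a'_def b'_def conj_cov_def fun_eq_iff)
    have "ext_deriv c' z = conj_cov (ext_deriv c z)"
      by (simp add: c'_def[abs_def] c_def ext_deriv_conj_coframe_t)
    also have "\<dots> = (\<lambda>vs. cnj k1 * conj_cov (a z \<and>\<^sub>w b z) vs + cnj k2 * conj_cov (a z \<and>\<^sub>w a' z) vs
      + cnj k3 * conj_cov (a z \<and>\<^sub>w b' z) vs + cnj k4 * conj_cov (b z \<and>\<^sub>w a' z) vs + cnj k5 * conj_cov (b z \<and>\<^sub>w b' z) vs)"
      by (simp add: dc conj_cov_def fun_eq_iff)
    finally show ?thesis
      by (simp add: conj_cov_wedge conj flip: a'_def b'_def)
  qed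
  have covectors: "a z = covector (\<lambda>v. a z [v])" "b z = covector (\<lambda>v. b z [v])" "c z = covector (\<lambda>v. c z [v])"
    "a' z = covector (\<lambda>v. a' z [v])" "b' z = covector (\<lambda>v. b' z [v])" "c' z = covector (\<lambda>v. c' z [v])" for z
    by (simp_all add: a_def b_def c_def a'_def b'_def c'_def alpha_t_eq beta_t_eq gamma_t_eq
        conj_cov_covector covector_single)
  note torsion = torsion_wedge_square[where fa = "\<lambda>v. a z [v]" and fb = "\<lambda>v. b z [v]" and fc = "\<lambda>v. c z [v]"
      and fa' = "\<lambda>v. a' z [v]" and fb' = "\<lambda>v. b' z [v]" and fc' = "\<lambda>v. c' z [v]" for z, folded covectors]
  note torsion_top = torsion_wedge_top[where fa = "\<lambda>v. a z [v]" and fb = "\<lambda>v. b z [v]"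
      and fa' = "\<lambda>v. a' z [v]" and fb' = "\<lambda>v. b' z [v]" for z, folded covectors]
  \<comment> \<open>\<open>U\<close> is the component of type (2,3) and \<open>V\<close>, its
    conjugate, that of type (3,2). The factor 2 comes from the square of the metric.\<close>
  define U where "U z = (\<lambda>vs. 2 * (k2 + k5) * (a z \<and>\<^sub>w b z \<and>\<^sub>w a' z \<and>\<^sub>w b' z \<and>\<^sub>w c' z) vs)" for z
  define V where "V z = (\<lambda>vs. 2 * (cnj k2 + cnj k5) * (a z \<and>\<^sub>w b z \<and>\<^sub>w c z \<and>\<^sub>w a' z \<and>\<^sub>w b' z) vs)" for z
  have d: "ext_deriv (form_power (\<omega>\<^sub>t t) 2) z = (\<lambda>vs. U z vs + V z vs)" for z
  proof -
    have wedge2: "(\<lambda>z. A z \<and>\<^sub>w B z) \<in> smooth_forms ?Y 2"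
      if "A \<in> smooth_forms ?Y 1" "B \<in> smooth_forms ?Y 1" for A B
      using smooth_forms_wedge[OF that] by (simp add: numeral_2_eq_2)
    have wedge3: "(\<lambda>z. A z \<and>\<^sub>w B z \<and>\<^sub>w C z) \<in> smooth_forms ?Y (1 + 2)"
      if "A \<in> smooth_forms ?Y 1" "B \<in> smooth_forms ?Y 1" "C \<in> smooth_forms ?Y 1" for A B C
      by (intro smooth_forms_wedge[of A, OF _ wedge2] that)
    have diff: "(\<lambda>z. (A z \<and>\<^sub>w B z \<and>\<^sub>w C z \<and>\<^sub>w D z) ws) differentiable at z"
      if "A \<in> smooth_forms ?Y 1" "B \<in> smooth_forms ?Y 1" "C \<in> smooth_forms ?Y 1" "D \<in> smooth_forms ?Y 1"
      for A B C D ws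
      by (intro differentiable_wedge that[THEN smooth_forms_differentiable])
    \<comment> \<open>This summand is a product of closed 1-forms, so only the two summands
      containing c and c' contribute.\<close>
    have "ext_deriv (\<lambda>z. a z \<and>\<^sub>w b z \<and>\<^sub>w a' z \<and>\<^sub>w b' z) z = (\<lambda>vs. 0)"
      by (simp add: d_closed(1)[OF wedge3[OF S(2,4,5)]] d_closed(2)[OF wedge2[OF S(4,5)]]
          d_closed(3)[OF S(5)] closed wedge_bilinear)
    moreover have "ext_deriv (\<lambda>z. f z \<and>\<^sub>w c z \<and>\<^sub>w f' z \<and>\<^sub>w c' z) z =
      (\<lambda>vs. - (f z \<and>\<^sub>w (\<lambda>vs. (ext_deriv c z \<and>\<^sub>w f' z \<and>\<^sub>w c' z) vs
        - (c z \<and>\<^sub>w (\<lambda>vs. - (f' z \<and>\<^sub>w ext_deriv c' z) vs)) vs)) vs)"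
      if "f \<in> smooth_forms ?Y 1" "ext_deriv f z = (\<lambda>vs. 0)"
        "f' \<in> smooth_forms ?Y 1" "ext_deriv f' z = (\<lambda>vs. 0)" for f f'
      unfolding ext_deriv_closed_wedge[OF that(1) wedge3[OF S(3) that(3) S(6)] that(2)]
        ext_deriv_one_form_wedge[OF S(3) wedge2[OF that(3) S(6)]]
        ext_deriv_closed_wedge[OF that(3) S(6) that(4)] ..
    from this[OF S(1) closed(1) S(4) closed(3)] this[OF S(2) closed(2) S(5) closed(4)]
    have "ext_deriv (\<lambda>z. a z \<and>\<^sub>w c z \<and>\<^sub>w a' z \<and>\<^sub>w c' z) z vs
        + ext_deriv (\<lambda>z. b z \<and>\<^sub>w c z \<and>\<^sub>w b' z \<and>\<^sub>w c' z) z vs =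
        (k2 + k5) * (a z \<and>\<^sub>w b z \<and>\<^sub>w a' z \<and>\<^sub>w b' z \<and>\<^sub>w c' z) vs
        + (cnj k2 + cnj k5) * (a z \<and>\<^sub>w b z \<and>\<^sub>w c z \<and>\<^sub>w a' z \<and>\<^sub>w b' z) vs" for vs
      using torsion[OF dc dc', where vs = vs] by simp
    moreover have "ext_deriv (\<lambda>z vs. 2 * (X z vs + (W z vs + W' z vs))) z
        = (\<lambda>vs. 2 * (ext_deriv X z vs + (ext_deriv W z vs + ext_deriv W' z vs)))"
      if "\<And>vs. (\<lambda>z. X z vs) differentiable at z" "\<And>vs. (\<lambda>z. W z vs) differentiable at z"
        "\<And>vs. (\<lambda>z. W' z vs) differentiable at z" for X W W' :: "(complex^3) form"
      using that by (simp add: ext_deriv_mult ext_deriv_add differentiable_add)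
    from this[OF diff[OF S(1,2,4,5)] diff[OF S(1,3,4,6)] diff[OF S(2,3,5,6)]]
    have "ext_deriv (form_power (\<omega>\<^sub>t t) 2) z = (\<lambda>vs. 2 *
      (ext_deriv (\<lambda>z. a z \<and>\<^sub>w b z \<and>\<^sub>w a' z \<and>\<^sub>w b' z) z vs
       + (ext_deriv (\<lambda>z. a z \<and>\<^sub>w c z \<and>\<^sub>w a' z \<and>\<^sub>w c' z) z vs
          + ext_deriv (\<lambda>z. b z \<and>\<^sub>w c z \<and>\<^sub>w b' z \<and>\<^sub>w c' z) z vs)))"
      unfolding omega_t_square a_def[symmetric] b_def[symmetric] c_def[symmetric]
        a'_def[symmetric] b'_def[symmetric] c'_def[symmetric] .
    ultimately show ?thesis
      by (simp add: U_def V_def) (simp add: algebra_simps)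
  qed
  have "delbar ?Y 2 2 (form_power (\<omega>\<^sub>t t) 2) z = U z" for z
  proof -
    \<comment> \<open>\<open>?C\<close> lists the components of the 5-form by their holomorphic
      degree r; \<open>delbar\<close> selects r = 2.\<close>
    let ?C = "\<lambda>r::nat. if r = 2 then U z else if r = 3 then V z else (\<lambda>vs. 0)"
    have mem: "{a z, b z, c z} = set (coframe_at ?Y z)"
      by (simp add: set_coframe_at_deform a_def b_def c_def)
    have "U z \<in> pq_covectors (coframe_at ?Y z) 2 3"
      using pq_covectors_single[of "[a z, b z]" "coframe_at ?Y z" 2 "[a z, b z, c z]" 3 "2 * (k2 + k5)"]
      by (simp add: U_def a'_def b'_def c'_def wedge_list_Cons wedge_list_Nil wedge_one_cov flip: mem)
    moreover have "V z \<in> pq_covectors (coframe_at ?Y z) 3 2"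
      using pq_covectors_single[of "[a z, b z, c z]" "coframe_at ?Y z" 3 "[a z, b z]" 2 "2 * (cnj k2 + cnj k5)"]
      by (simp add: V_def a'_def b'_def c'_def wedge_list_Cons wedge_list_Nil wedge_one_cov flip: mem)
    ultimately have "?C r \<in> pq_covectors (coframe_at ?Y z) r (2 + Suc 2 - r)" for r
      by (simp add: pq_covectors_zero)
    moreover have "ext_deriv (form_power (\<omega>\<^sub>t t) 2) z = (\<lambda>vs. \<Sum>r\<le>2 + Suc 2. ?C r vs)"
      unfolding d by (simp add: atMost_Suc numeral_eq_Suc add.commute)
    ultimately have "pq_part ?Y 2 (Suc 2) (ext_deriv (form_power (\<omega>\<^sub>t t) 2)) z = ?C 2"
      by (intro pq_part_eq[OF Y, where C = ?C])
    then show ?thesis by (simp add: delbar_def)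
  qed
  then have "delbar ?Y 2 2 (form_power (\<omega>\<^sub>t t) 2) = U"
    by (rule ext)
  moreover have "ext_deriv U z = (\<lambda>vs. 0)" for z
  proof -
    \<comment> \<open>The product is built up from the right, and d passes through the closed
      factors until it reaches c'.\<close>
    note forms = smooth_forms_wedge[OF S(5) S(6)]
    note forms = forms smooth_forms_wedge[OF S(4) forms]
    note forms = forms smooth_forms_wedge[OF S(2) forms(2)]
    note diff = smooth_forms_differentiable[OF smooth_forms_wedge[OF S(1) forms(3)]]
    show ?thesis
      unfolding U_def[abs_def] ext_deriv_mult[OF diff]
      by (simp add: d_closed(1)[OF forms(3)] d_closed(2)[OF forms(2)] d_closed(3)[OF forms(1)] d_closed(4)[OF S(6)]
          wedge_bilinear torsion_top[OF dc'])
  qed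
  ultimately show ?thesis
    by (simp add: deldelbar_def del_def pq_part_zero[OF Y] ext)
qed

section \<open>Membership in the Gauduchon cone\<close>

lemma cdim_iwasawa_deform: "cdim (iwasawa_deform t) = 3"
  by (simp add: cdim_def iwasawa_deform_def)

theorem lemma6p1:
  fixes \<Delta> :: "kuranishi_param set" and t :: kuranishi_param
  assumes "kuranishi_base \<Delta>" and "t \<in> base_\<gamma> \<Delta>"
  shows "gauduchon_metric (iwasawa_deform t) (\<omega>\<^sub>t t) \<and>
    aeppli_class (iwasawa_deform t) 2 2 (form_power (\<omega>\<^sub>t t) 2) \<in> gauduchon_cone (iwasawa_deform t)"
proof
  let ?Y = "iwasawa_deform t" and ?\<Omega> = "form_power (\<omega>\<^sub>t t) 2"
  have Y: "complex_structure ?Y" and t: "t$3$1 = 0" "t$3$2 = 0"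
    using assms by (auto simp: kuranishi_base_def base_\<gamma>_def)
  have ddbar: "deldelbar ?Y 2 2 ?\<Omega> = (\<lambda>z vs. 0)"
    by (rule deldelbar_omega_t_square[OF Y t])
  show gauduchon: "gauduchon_metric ?Y (\<omega>\<^sub>t t)"
    using hermitian_metric_omega_t[OF Y] ddbar by (simp add: gauduchon_metric_def cdim_iwasawa_deform)
  \<comment> \<open>The class is real because it contains the real form \<open>?\<Omega>\<close>
    itself, obtained by adding the zero forms of both images.\<close>
  have "?\<Omega> \<in> aeppli_class ?Y 2 2 ?\<Omega>"
    unfolding aeppli_class_def im_del_def im_delbar_def
    by (intro CollectI exI[of _ "\<lambda>z vs. 0"]) simp
  moreover have "?\<Omega> \<in> aeppli_closed ?Y 2 2"
    by (simp add: aeppli_closed_def omega_t_square_pq_forms ddbar)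
  ultimately have "aeppli_class ?Y 2 2 ?\<Omega> \<in> real_aeppli ?Y 2"
    using real_form_omega_t_square unfolding real_aeppli_def aeppli_def by blast
  then show "aeppli_class ?Y 2 2 ?\<Omega> \<in> gauduchon_cone ?Y"
    using gauduchon unfolding gauduchon_cone_def by (auto simp: cdim_iwasawa_deform)
qed

end
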